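(* If $f\in\mathbb{R}[x_1,\ldots,x_n]$ and $f\in\mathrm{SONC}$, then $f$ decomposes into a sum of nonnegative circuit polynomials without cancellation. That is, writing $f=\sum_{\boldsymbol{\alpha}\in\Lambda(f)}c_{\boldsymbol{\alpha}}\mathbf{x}^{\boldsymbol{\alpha}}-\sum_{\boldsymbol{\beta}\in\Gamma(f)}d_{\boldsymbol{\beta}}\mathbf{x}^{\boldsymbol{\beta}}$, there is a decomposition $$f=\sum_{\boldsymbol{\beta}\in\Gamma(f)}\ \sum_{\Delta\in\mathscr{F}(\boldsymbol{\beta})}f_{\boldsymbol{\beta}\Delta}+\sum_{\boldsymbol{\alpha}\in\mathscr{I}}c_{\boldsymbol{\alpha}}\mathbf{x}^{\boldsymbol{\alpha}},$$ where each $f_{\boldsymbol{\beta}\Delta}$ is a nonnegative circuit polynomial supported on $V(\Delta)\cup\{\boldsymbol{\beta}\}$ (with coefficients allowed to vanish), and $\mathscr{I}=\{\boldsymbol{\alpha}\in\Lambda(f)\mid\boldsymbol{\alpha}\notin\bigcup_{\boldsymbol{\beta}\in\Gamma(f)}\bigcup_{\Delta\in\mathscr{F}(\boldsymbol{\beta})}V(\Delta)\}$.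
   Context: Here $\mathbb{N}$ contains $0$, and $\mathbf{x}^{\boldsymbol{\alpha}}=x_1^{\alpha_1}\cdots x_n^{\alpha_n}$. A trellis is a finite set $\mathscr{A}\subseteq(2\mathbb{N})^n$ comprising the vertices of a simplex (of any dimension). A circuit polynomial is a polynomial of the form $\sum_{\boldsymbol{\alpha}\in\mathscr{A}}c_{\boldsymbol{\alpha}}\mathbf{x}^{\boldsymbol{\alpha}}-d\mathbf{x}^{\boldsymbol{\beta}}$ where $\mathscr{A}$ is a trellis, $c_{\boldsymbol{\alpha}}>0$ for all $\boldsymbol{\alpha}\in\mathscr{A}$, $d\in\mathbb{R}$, and $\boldsymbol{\beta}\in\mathbb{N}^n$ lies in the relative interior of the convex hull of $\mathscr{A}$. A nonnegative circuit polynomial is a circuit polynomial that is nonnegative on $\mathbb{R}^n$; by convention a monomial square $c\mathbf{x}^{\boldsymbol{\alpha}}$ with $c>0$, $\boldsymbol{\alpha}\in(2\mathbb{N})^n$ is also regarded as one. $\mathrm{SONC}$ is the convex cone of all (finite, possibly empty) sums of nonnegative circuit polynomials. For a nonnegative polynomial $f$ with coefficient $c_{\boldsymbol{\alpha}}$ at $\mathbf{x}^{\boldsymbol{\alpha}}$, $\mathrm{supp}(f)$ is the set of exponents with nonzero coefficient, $\Lambda(f):=\{\boldsymbol{\alpha}\in\mathrm{supp}(f)\mid\boldsymbol{\alpha}\in(2\mathbb{N})^n\text{ and }c_{\boldsymbol{\alpha}}>0\}$, $\Gamma(f):=\mathrm{supp}(f)\setminus\Lambda(f)$, and $d_{\boldsymbol{\beta}}:=-c_{\boldsymbol{\beta}}$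 for $\boldsymbol{\beta}\in\Gamma(f)$. $V(\Delta)$ is the vertex set of a polytope $\Delta$. For $\boldsymbol{\beta}\in\Gamma(f)$, $\mathscr{F}(\boldsymbol{\beta})$ is the set of all simplices $\Delta$ (of any dimension) with $V(\Delta)\subseteq\Lambda(f)$ and $\boldsymbol{\beta}$ in the relative interior of $\Delta$. "Nonnegative circuit polynomial supported on $V(\Delta)\cup\{\boldsymbol{\beta}\}$ (with coefficients allowed to vanish)" means a polynomial, nonnegative on $\mathbb{R}^n$, of the form $\sum_{\boldsymbol{\alpha}\in V(\Delta)}a_{\boldsymbol{\alpha}}\mathbf{x}^{\boldsymbol{\alpha}}-d\,\mathbf{x}^{\boldsymbol{\beta}}$ with $a_{\boldsymbol{\alpha}}\ge 0$ and $d\in\mathbb{R}$. *)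

theory Defs
  imports "HOL-Analysis.Analysis" "HOL-Library.Poly_Mapping"
begin

text \<open>
  The polynomial ring in the variables indexed by \<open>'n\<close> is the monoid algebra of
  \<open>nat ^ 'n\<close> over the reals: \<open>lookup f \<alpha>\<close> is the coefficient of \<open>f\<close> at the exponent \<open>\<alpha>\<close>,
  \<open>keys f\<close> is the support of \<open>f\<close>, and \<open>single \<alpha> c\<close> is the term with coefficient \<open>c\<close>
  and exponent \<open>\<alpha>\<close>.
\<close>

type_synonym 'n rpoly = "(nat ^ 'n) \<Rightarrow>\<^sub>0 real"

definition eval_poly :: "'n::finite rpoly \<Rightarrow> real ^ 'n \<Rightarrow> real" where
  "eval_poly f x = (\<Sum>\<alpha>\<in>Poly_Mapping.keys f. Poly_Mapping.lookup f \<alpha> * (\<Prod>i\<in>UNIV. (x $ i) ^ (\<alpha> $ i)))"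

definition nonneg_poly :: "'n::finite rpoly \<Rightarrow> bool" where
  "nonneg_poly f \<longleftrightarrow> (\<forall>x. 0 \<le> eval_poly f x)"

definition even_exp :: "nat ^ 'n::finite \<Rightarrow> bool" where
  "even_exp \<alpha> \<longleftrightarrow> (\<forall>i. even (\<alpha> $ i))"

definition point :: "nat ^ 'n::finite \<Rightarrow> real ^ 'n" where
  "point \<alpha> = (\<chi> i. real (\<alpha> $ i))"

definition vertices :: "(real ^ 'n::finite) set \<Rightarrow> (real ^ 'n) set" where
  "vertices \<Delta> = {v. v extreme_point_of \<Delta>}"

text \<open>The library predicate also accepts the empty set, as a simplex of dimension \<open>-1\<close>;
  quantifying the dimension over the naturals excludes it.\<close>

definition is_simplex :: "(real ^ 'n::finite) set \<Rightarrow> bool" where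
  "is_simplex \<Delta> \<longleftrightarrow> (\<exists>k::nat. int k simplex \<Delta>)"

definition trellis :: "(nat ^ 'n::finite) set \<Rightarrow> bool" where
  "trellis A \<longleftrightarrow> finite A \<and> (\<forall>\<alpha>\<in>A. even_exp \<alpha>) \<and>
     (\<exists>\<Delta>. is_simplex \<Delta> \<and> vertices \<Delta> = point ` A)"

definition circuit_poly :: "'n::finite rpoly \<Rightarrow> bool" where
  "circuit_poly f \<longleftrightarrow> (\<exists>A c d \<beta>. trellis A \<and> (\<forall>\<alpha>\<in>A. 0 < c \<alpha>) \<and>
     point \<beta> \<in> rel_interior (convex hull (point ` A)) \<and>
     f = (\<Sum>\<alpha>\<in>A. Poly_Mapping.single \<alpha> (c \<alpha>)) - Poly_Mapping.single \<beta> d)"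

definition monomial_square :: "'n::finite rpoly \<Rightarrow> bool" where
  "monomial_square f \<longleftrightarrow> (\<exists>\<alpha> c. 0 < c \<and> even_exp \<alpha> \<and> f = Poly_Mapping.single \<alpha> c)"

definition nonneg_circuit_poly :: "'n::finite rpoly \<Rightarrow> bool" where
  "nonneg_circuit_poly f \<longleftrightarrow> (circuit_poly f \<and> nonneg_poly f) \<or> monomial_square f"

definition SONC :: "'n::finite rpoly set" where
  "SONC = {sum_list fs | fs. \<forall>g\<in>set fs. nonneg_circuit_poly g}"

definition \<Lambda> :: "'n::finite rpoly \<Rightarrow> (nat ^ 'n) set" where
  "\<Lambda> f = {\<alpha> \<in> Poly_Mapping.keys f. even_exp \<alpha> \<and> 0 < Poly_Mapping.lookup f \<alpha>}"

definition \<Gamma> :: "'n::finite rpoly \<Rightarrow> (nat ^ 'n) set" where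
  "\<Gamma> f = Poly_Mapping.keys f - \<Lambda> f"

definition vertex_exps :: "(real ^ 'n::finite) set \<Rightarrow> (nat ^ 'n) set" where
  "vertex_exps \<Delta> = {\<alpha>. point \<alpha> \<in> vertices \<Delta>}"

definition \<F> :: "'n::finite rpoly \<Rightarrow> nat ^ 'n \<Rightarrow> (real ^ 'n) set set" where
  "\<F> f \<beta> = {\<Delta>. is_simplex \<Delta> \<and> vertices \<Delta> \<subseteq> point ` \<Lambda> f \<and> point \<beta> \<in> rel_interior \<Delta>}"

text \<open>The coefficients are allowed to vanish, so \<open>g\<close> need not satisfy \<open>circuit_poly\<close>.\<close>

definition nonneg_circuit_on :: "(real ^ 'n::finite) set \<Rightarrow> nat ^ 'n \<Rightarrow> 'n rpoly \<Rightarrow> bool" where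
  "nonneg_circuit_on \<Delta> \<beta> g \<longleftrightarrow> nonneg_poly g \<and>
     (\<exists>a d. (\<forall>\<alpha>\<in>vertex_exps \<Delta>. 0 \<le> a \<alpha>) \<and>
       g = (\<Sum>\<alpha>\<in>vertex_exps \<Delta>. Poly_Mapping.single \<alpha> (a \<alpha>)) - Poly_Mapping.single \<beta> d)"

definition \<I> :: "'n::finite rpoly \<Rightarrow> (nat ^ 'n) set" where
  "\<I> f = {\<alpha> \<in> \<Lambda> f. \<alpha> \<notin> (\<Union>\<beta>\<in>\<Gamma> f. \<Union>\<Delta>\<in>\<F> f \<beta>. vertex_exps \<Delta>)}"

text \<open>The index sets of the sums over \<open>\<F> f \<beta>\<close> and \<open>vertex_exps \<Delta>\<close> are finite, so
  these sums do not degenerate to \<open>0\<close>.\<close>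

lemma inj_point: "inj point"
  by (auto simp: inj_def point_def vec_eq_iff)

lemma finite_\<Lambda>: "finite (\<Lambda> f)"
  by (rule finite_subset[of _ "Poly_Mapping.keys f"]) (auto simp: \<Lambda>_def)

lemma simplex_hull_vertices:
  assumes "is_simplex \<Delta>"
  shows "\<Delta> = convex hull (vertices \<Delta>)"
proof -
  obtain k :: nat where "int k simplex \<Delta>" using assms by (auto simp: is_simplex_def)
  then have "convex \<Delta>" "compact \<Delta>" by (auto simp: convex_simplex compact_simplex)
  then show ?thesis unfolding vertices_def by (intro Krein_Milman_Minkowski)
qed

lemma finite_\<F>: "finite (\<F> f \<beta>)"
proof (rule finite_subset)
  show "\<F> f \<beta> \<subseteq> (\<lambda>V. convex hull V) ` Pow (point ` \<Lambda> f)"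
  proof
    fix \<Delta> assume "\<Delta> \<in> \<F> f \<beta>"
    then have "\<Delta> = convex hull (vertices \<Delta>)" "vertices \<Delta> \<in> Pow (point ` \<Lambda> f)"
      using simplex_hull_vertices by (auto simp: \<F>_def)
    then show "\<Delta> \<in> (\<lambda>V. convex hull V) ` Pow (point ` \<Lambda> f)" by (rule image_eqI)
  qed
qed (simp add: finite_\<Lambda>)

lemma vertex_exps_subset: "\<Delta> \<in> \<F> f \<beta> \<Longrightarrow> vertex_exps \<Delta> \<subseteq> \<Lambda> f"
  using inj_point by (auto simp: \<F>_def vertex_exps_def dest: injD)

lemma finite_vertex_exps: "\<Delta> \<in> \<F> f \<beta> \<Longrightarrow> finite (vertex_exps \<Delta>)"
  using vertex_exps_subset finite_\<Lambda> by (rule finite_subset)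

end

theory Submission
  imports Defs
begin

text \<open>
  The proof replaces circuit polynomials by AGE polynomials, that is, by nonnegative polynomials
  with at most one term that is not a monomial square. A nonnegative circuit polynomial is of this
  kind, and AGE polynomials with the same exceptional exponent \<open>\<beta>\<close> can be added, so every
  \<open>f \<in> SONC\<close> is a sum of AGE polynomials \<open>g \<beta>\<close> with distinct \<open>\<beta>\<close> (\<open>SONC_age_sum\<close>).

  Cancellation is easy to remove at this level. If \<open>g \<gamma>\<close> has a negative coefficient at \<open>\<gamma>\<close> that
  is met by positive coefficients of the other summands, then suitable nonnegative multiples of
  \<open>g \<gamma>\<close> are moved to those summands until either \<open>g \<gamma>\<close> or the positive coefficients are used up
  (\<open>settle_one\<close>). Nonnegativity and the sum are preserved, and one exponent can be treated after
  the other. In the end every \<open>g \<beta>\<close> has its exponents other than \<open>\<beta>\<close> in \<open>\<Lambda> f\<close>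
  (\<open>settled_piece_decomposable\<close>).

  It remains to split an AGE polynomial into circuit polynomials on its own support
  (\<open>age_decomposable\<close>). Write its coefficients as \<open>c\<close> and the exceptional term as \<open>- d x^\<beta>\<close>, say
  with \<open>d > 0\<close>. In logarithmic coordinates nonnegativity says that
  \<open>\<Sum>\<alpha>. c \<alpha> * exp ((\<alpha> - \<beta>) \<bullet> y) \<ge> d\<close> for all \<open>y\<close>. After discarding some terms the left side attains a
  minimum that is still at least \<open>d\<close> (\<open>stationary_subsum\<close>). The vanishing gradient says that the
  terms \<open>\<nu> \<alpha>\<close> of the sum at the minimum are weights balanced around \<open>\<beta>\<close>:
  \<open>\<Sum>\<alpha>. \<nu> \<alpha> * (\<alpha> - \<beta>) = 0\<close>. By an argument of Caratheodory, \<open>\<nu>\<close> is a sum of balanced weights with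
  affinely independent supports (\<open>balanced_weights_induct\<close>), and the polynomial splits along with
  \<open>\<nu>\<close>. Each part is supported on the vertices of a simplex and the interior point \<open>\<beta>\<close>, and is
  nonnegative by the inequality \<open>exp u \<ge> 1 + u\<close> (\<open>balanced_exponential_nonneg\<close>).
\<close>

section \<open>Polynomials as functions\<close>

lemma eval_poly_superset:
  assumes "finite S" "Poly_Mapping.keys f \<subseteq> S"
  shows "eval_poly f x = (\<Sum>\<alpha>\<in>S. Poly_Mapping.lookup f \<alpha> * (\<Prod>i\<in>UNIV. (x $ i) ^ (\<alpha> $ i)))"
  unfolding eval_poly_def
  by (rule sum.mono_neutral_left) (use assms in \<open>auto simp: in_keys_iff\<close>)

lemma eval_poly_add: "eval_poly (f + g) x = eval_poly f x + eval_poly g x"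
  using keys_add[of f g]
  by (simp add: eval_poly_superset[of "Poly_Mapping.keys f \<union> Poly_Mapping.keys g"]
      lookup_add distrib_right sum.distrib)

lemma eval_poly_0 [simp]: "eval_poly 0 x = 0"
  by (simp add: eval_poly_def)

lemma eval_poly_uminus [simp]: "eval_poly (- f) x = - eval_poly f x"
  using eval_poly_add[of f "- f" x] by simp

lemma eval_poly_diff: "eval_poly (f - g) x = eval_poly f x - eval_poly g x"
  using eval_poly_add[of f "- g" x] by simp

lemma eval_poly_sum: "eval_poly (\<Sum>k\<in>K. f k) x = (\<Sum>k\<in>K. eval_poly (f k) x)"
  by (induction K rule: infinite_finite_induct) (auto simp: eval_poly_add)

lemma eval_poly_single:
  "eval_poly (Poly_Mapping.single \<alpha> c) x = c * (\<Prod>i\<in>UNIV. (x $ i) ^ (\<alpha> $ i))"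
  by (cases "c = 0") (auto simp: eval_poly_def)

lemma lookup_sum_single:
  "Poly_Mapping.lookup (\<Sum>\<alpha>\<in>S. Poly_Mapping.single \<alpha> (c \<alpha>)) k = (if finite S \<and> k \<in> S then c k else 0)"
proof -
  have "(\<Sum>\<alpha>\<in>S. Poly_Mapping.lookup (Poly_Mapping.single \<alpha> (c \<alpha>)) k) = (\<Sum>\<alpha>\<in>S. if \<alpha> = k then c k else 0)"
    by (intro sum.cong) (auto simp: lookup_single when_def)
  then show ?thesis by (cases "finite S") (auto simp: lookup_sum)
qed

lemma sum_single_lookup:
  assumes "finite S" "Poly_Mapping.keys g \<subseteq> S"
  shows "g = (\<Sum>\<alpha>\<in>S. Poly_Mapping.single \<alpha> (Poly_Mapping.lookup g \<alpha>))"
  by (rule poly_mapping_eqI) (use assms in \<open>auto simp: lookup_sum_single in_keys_iff\<close>)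

lemma lookup_scale: "Poly_Mapping.lookup (Poly_Mapping.map ((*) (r::real)) f) \<alpha> = r * Poly_Mapping.lookup f \<alpha>"
  by (simp add: map.rep_eq when_def)

lemma eval_poly_scale: "eval_poly (Poly_Mapping.map ((*) r) f) x = r * eval_poly f x"
proof -
  have "Poly_Mapping.keys (Poly_Mapping.map ((*) r) f) \<subseteq> Poly_Mapping.keys f"
    by (auto simp: in_keys_iff lookup_scale)
  then show ?thesis
    by (simp add: eval_poly_superset[of "Poly_Mapping.keys f"] lookup_scale sum_distrib_left mult.assoc)
qed

lemma nonneg_poly_add: "nonneg_poly f \<Longrightarrow> nonneg_poly g \<Longrightarrow> nonneg_poly (f + g)"
  by (simp add: nonneg_poly_def eval_poly_add)

lemma exp_inner_point:
  "exp (point \<alpha> \<bullet> y) = (\<Prod>i\<in>UNIV. exp (y $ i) ^ (\<alpha> $ i))"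
  by (simp add: point_def inner_vec_def exp_sum exp_of_nat_mult)

lemma even_monomial_abs:
  fixes x :: "real ^ 'n::finite"
  assumes "even_exp \<alpha>"
  shows "(\<Prod>i\<in>UNIV. (x $ i) ^ (\<alpha> $ i)) = (\<Prod>i\<in>UNIV. \<bar>x $ i\<bar> ^ (\<alpha> $ i))"
  by (intro prod.cong refl) (use assms in \<open>simp add: even_exp_def power_even_abs\<close>)

lemma nonneg_poly_single:
  assumes "even_exp \<alpha>" "0 \<le> c"
  shows "nonneg_poly (Poly_Mapping.single \<alpha> c)"
  unfolding nonneg_poly_def eval_poly_single even_monomial_abs[OF assms(1)]
  using assms(2) by (auto intro!: mult_nonneg_nonneg prod_nonneg)

section \<open>Splitting a balanced weight into affinely independent ones\<close>

text \<open>
  Moving from a positive weight \<open>\<nu>\<close> in a direction \<open>w\<close> that decreases some entry, stop at the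
  first entry to vanish.
\<close>

lemma step_to_boundary:
  fixes \<nu> w :: "'a \<Rightarrow> real"
  assumes "finite B" "\<And>\<alpha>. \<alpha> \<in> B \<Longrightarrow> 0 < \<nu> \<alpha>" "\<exists>\<alpha>\<in>B. w \<alpha> < 0"
  obtains t \<alpha> where "0 < t" "\<alpha> \<in> B" "\<nu> \<alpha> + t * w \<alpha> = 0"
    "\<And>\<alpha>. \<alpha> \<in> B \<Longrightarrow> 0 \<le> \<nu> \<alpha> + t * w \<alpha>"
proof -
  define N where "N = {\<alpha>\<in>B. w \<alpha> < 0}"
  define t where "t = Min ((\<lambda>\<alpha>. \<nu> \<alpha> / - w \<alpha>) ` N)"
  have N: "finite N" "N \<noteq> {}" using assms by (auto simp: N_def)
  then have "t \<in> (\<lambda>\<alpha>. \<nu> \<alpha> / - w \<alpha>) ` N" unfolding t_def by (intro Min_in) auto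
  then obtain \<alpha> where \<alpha>: "\<alpha> \<in> N" "t = \<nu> \<alpha> / - w \<alpha>" by auto
  then have t: "0 < t" using assms(2)[of \<alpha>] by (simp add: N_def divide_pos_neg)
  have "0 \<le> \<nu> \<gamma> + t * w \<gamma>" if "\<gamma> \<in> B" for \<gamma>
  proof (cases "\<gamma> \<in> N")
    case True
    then have "t \<le> \<nu> \<gamma> / - w \<gamma>" unfolding t_def using N by (intro Min_le) auto
    then show ?thesis using True by (simp add: N_def field_simps)
  next
    case False
    then have "0 \<le> w \<gamma>" using that by (auto simp: N_def)
    then show ?thesis using t assms(2)[OF that] by simp
  qed
  moreover have "\<nu> \<alpha> + t * w \<alpha> = 0" using \<alpha> by (auto simp: N_def)
  ultimately show ?thesis using that t \<alpha>(1) by (auto simp: N_def)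
qed

text \<open>
  A conic Caratheodory theorem in the form of an induction rule: the weights \<open>\<nu> \<ge> 0\<close> that are
  balanced around \<open>b\<close> are sums of such weights with affinely independent supports. As long as
  the support is affinely dependent, the coefficients of a dependence give a direction \<open>w\<close> that
  keeps the balance. Their sum is zero, so \<open>w\<close> has entries of both signs, and following \<open>w\<close> and
  \<open>- w\<close> until an entry vanishes exhibits \<open>\<nu>\<close> as a convex combination of two balanced weights
  of smaller support.
\<close>

lemma balanced_weights_induct:
  fixes p :: "'a \<Rightarrow> 'b::euclidean_space" and \<nu> :: "'a \<Rightarrow> real"
  assumes A: "finite A" "inj_on p A"
    and zero: "P (\<lambda>\<alpha>. 0)"
    and add: "\<And>\<mu> \<nu>. P \<mu> \<Longrightarrow> P \<nu> \<Longrightarrow> P (\<lambda>\<alpha>. \<mu> \<alpha> + \<nu> \<alpha>)"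
    and indep: "\<And>B \<nu>. B \<subseteq> A \<Longrightarrow> B \<noteq> {} \<Longrightarrow> \<not> affine_dependent (p ` B) \<Longrightarrow>
      (\<And>\<alpha>. \<alpha> \<in> B \<Longrightarrow> 0 < \<nu> \<alpha>) \<Longrightarrow> (\<And>\<alpha>. \<alpha> \<notin> B \<Longrightarrow> \<nu> \<alpha> = 0) \<Longrightarrow>
      (\<Sum>\<alpha>\<in>B. \<nu> \<alpha> *\<^sub>R (p \<alpha> - b)) = 0 \<Longrightarrow> P \<nu>"
    and \<nu>: "\<And>\<alpha>. 0 \<le> \<nu> \<alpha>" "\<And>\<alpha>. \<alpha> \<notin> A \<Longrightarrow> \<nu> \<alpha> = 0"
      "(\<Sum>\<alpha>\<in>A. \<nu> \<alpha> *\<^sub>R (p \<alpha> - b)) = 0"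
  shows "P \<nu>"
  using \<nu>
proof (induction "card {\<alpha>\<in>A. \<nu> \<alpha> \<noteq> 0}" arbitrary: \<nu> rule: less_induct)
  case less
  define B where "B = {\<alpha>\<in>A. \<nu> \<alpha> \<noteq> 0}"
  have B: "finite B" "B \<subseteq> A" "inj_on p B"
    using A by (auto simp: B_def intro: inj_on_subset)
  have pos: "0 < \<nu> \<alpha>" if "\<alpha> \<in> B" for \<alpha>
    using that less.prems(1)[of \<alpha>] by (auto simp: B_def)
  have off: "\<nu> \<alpha> = 0" if "\<alpha> \<notin> B" for \<alpha>
    using that less.prems(2)[of \<alpha>] by (auto simp: B_def)
  show ?case
  proof (cases "affine_dependent (p ` B)")
    case False
    show ?thesis
    proof (cases "B = {}")
      case True
      then have "\<nu> = (\<lambda>\<alpha>. 0)" using off by auto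
      then show ?thesis using zero by simp
    next
      case nonempty: False
      have "(\<Sum>\<alpha>\<in>B. \<nu> \<alpha> *\<^sub>R (p \<alpha> - b)) = (\<Sum>\<alpha>\<in>A. \<nu> \<alpha> *\<^sub>R (p \<alpha> - b))"
        by (rule sum.mono_neutral_left) (use A B off in auto)
      then show ?thesis
        using less.prems(3) False nonempty B pos off by (intro indep[of B]) auto
    qed
  next
    case True
    then obtain U where U: "sum U (p ` B) = 0" "\<exists>v\<in>p ` B. U v \<noteq> 0"
      "(\<Sum>v\<in>p ` B. U v *\<^sub>R v) = 0"
      using affine_dependent_explicit_finite[of "p ` B"] B by auto
    define w where "w \<alpha> = (if \<alpha> \<in> B then U (p \<alpha>) else 0)" for \<alpha>
    have w: "sum w B = 0" "(\<Sum>\<alpha>\<in>B. w \<alpha> *\<^sub>R p \<alpha>) = 0" "\<exists>\<alpha>\<in>B. w \<alpha> \<noteq> 0"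
      using U B by (auto simp: w_def sum.reindex)
    have neg: "\<exists>\<alpha>\<in>B. s * w \<alpha> < 0" if "s \<noteq> 0" for s
    proof (rule ccontr)
      assume "\<not> ?thesis"
      then have "\<And>\<alpha>. \<alpha> \<in> B \<Longrightarrow> 0 \<le> s * w \<alpha>" by (auto simp: not_less)
      moreover have "(\<Sum>\<alpha>\<in>B. s * w \<alpha>) = 0" using w(1) by (simp flip: sum_distrib_left)
      ultimately have "\<forall>\<alpha>\<in>B. s * w \<alpha> = 0" using B by (simp add: sum_nonneg_eq_0_iff)
      then show False using w(3) that by auto
    qed
    have smaller: "P (\<lambda>\<alpha>. r * (\<nu> \<alpha> + t * w \<alpha>))"
      if "0 < r" and "\<alpha> \<in> B" "\<nu> \<alpha> + t * w \<alpha> = 0"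
        and nn: "\<And>\<alpha>. \<alpha> \<in> B \<Longrightarrow> 0 \<le> \<nu> \<alpha> + t * w \<alpha>" for r t \<alpha>
    proof (rule less.hyps)
      have "{\<alpha> \<in> A. r * (\<nu> \<alpha> + t * w \<alpha>) \<noteq> 0} \<subset> B"
        using that(2,3) off by (auto simp: w_def)
      then show "card {\<alpha> \<in> A. r * (\<nu> \<alpha> + t * w \<alpha>) \<noteq> 0} < card {\<alpha> \<in> A. \<nu> \<alpha> \<noteq> 0}"
        using B(1) psubset_card_mono unfolding B_def by blast
      show "0 \<le> r * (\<nu> \<alpha> + t * w \<alpha>)" for \<alpha>
        using nn[of \<alpha>] off[of \<alpha>] \<open>0 < r\<close> by (cases "\<alpha> \<in> B") (auto simp: w_def)
      show "r * (\<nu> \<alpha> + t * w \<alpha>) = 0" if "\<alpha> \<notin> A" for \<alpha>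
        using that B off by (auto simp: w_def)
      have "(\<Sum>\<alpha>\<in>A. w \<alpha> *\<^sub>R (p \<alpha> - b)) = (\<Sum>\<alpha>\<in>B. w \<alpha> *\<^sub>R (p \<alpha> - b))"
        by (rule sum.mono_neutral_right) (use A B in \<open>auto simp: w_def\<close>)
      also have "\<dots> = 0"
        using w(1,2) by (simp add: scaleR_diff_right sum_subtractf flip: scaleR_left.sum)
      finally have "(\<Sum>\<alpha>\<in>A. w \<alpha> *\<^sub>R (p \<alpha> - b)) = 0" .
      moreover have "(\<Sum>\<alpha>\<in>A. (r * (\<nu> \<alpha> + t * w \<alpha>)) *\<^sub>R (p \<alpha> - b)) =
          r *\<^sub>R (\<Sum>\<alpha>\<in>A. \<nu> \<alpha> *\<^sub>R (p \<alpha> - b)) + (r * t) *\<^sub>R (\<Sum>\<alpha>\<in>A. w \<alpha> *\<^sub>R (p \<alpha> - b))"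
        by (simp add: scaleR_sum_right sum.distrib scaleR_add_left distrib_left mult.assoc)
      ultimately show "(\<Sum>\<alpha>\<in>A. (r * (\<nu> \<alpha> + t * w \<alpha>)) *\<^sub>R (p \<alpha> - b)) = 0"
        using less.prems(3) by simp
    qed
    obtain t \<alpha> where t: "0 < t" "\<alpha> \<in> B" "\<nu> \<alpha> + t * w \<alpha> = 0"
      "\<And>\<alpha>. \<alpha> \<in> B \<Longrightarrow> 0 \<le> \<nu> \<alpha> + t * w \<alpha>"
      using step_to_boundary[of B \<nu> w] B pos neg[of 1] by auto
    obtain s \<gamma> where s: "0 < s" "\<gamma> \<in> B" "\<nu> \<gamma> + s * - w \<gamma> = 0"
      "\<And>\<alpha>. \<alpha> \<in> B \<Longrightarrow> 0 \<le> \<nu> \<alpha> + s * - w \<alpha>"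
      using step_to_boundary[of B \<nu> "\<lambda>\<alpha>. - w \<alpha>"] B pos neg[of "-1"] by auto
    have "P (\<lambda>\<alpha>. s / (s + t) * (\<nu> \<alpha> + t * w \<alpha>) + t / (s + t) * (\<nu> \<alpha> + - s * w \<alpha>))"
      by (rule add; rule smaller) (use s t in auto)
    moreover have "s / (s + t) * (\<nu> \<alpha> + t * w \<alpha>) + t / (s + t) * (\<nu> \<alpha> + - s * w \<alpha>) = \<nu> \<alpha>" for \<alpha>
    proof -
      have "s / (s + t) * (\<nu> \<alpha> + t * w \<alpha>) + t / (s + t) * (\<nu> \<alpha> + - s * w \<alpha>)
        = (s * (\<nu> \<alpha> + t * w \<alpha>) + t * (\<nu> \<alpha> - s * w \<alpha>)) / (s + t)"
        by (simp add: add_divide_distrib)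
      also have "s * (\<nu> \<alpha> + t * w \<alpha>) + t * (\<nu> \<alpha> - s * w \<alpha>) = (s + t) * \<nu> \<alpha>"
        by (simp add: algebra_simps)
      finally show ?thesis using s(1) t(1) by simp
    qed
    ultimately show ?thesis by simp
  qed
qed

section \<open>Stationary points of exponential sums\<close>

text \<open>
  An exponential sum that stays above \<open>d > 0\<close> need not attain its infimum, but a subsum with
  the same lower bound does. If some direction \<open>u\<close> increases no exponent and decreases one, then
  letting the argument run to infinity along \<open>u\<close> removes the decreasing terms and keeps the bound,
  so that induction applies. Otherwise every nonzero direction in the span of the \<open>v \<alpha>\<close> increases
  an exponent; hence the sum is coercive on that span and attains a minimum there. The vector in
  the conclusion is the gradient, which lies in the span as well and therefore vanishes at the
  minimum.
\<close>

lemma stationary_subsum: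
  fixes v :: "'a \<Rightarrow> 'b::euclidean_space" and c :: "'a \<Rightarrow> real"
  assumes "finite A" "\<And>\<alpha>. \<alpha> \<in> A \<Longrightarrow> 0 < c \<alpha>" "0 < d"
    and "\<And>y. d \<le> (\<Sum>\<alpha>\<in>A. c \<alpha> * exp (v \<alpha> \<bullet> y))"
  shows "\<exists>B y. B \<subseteq> A \<and> (\<Sum>\<alpha>\<in>B. (c \<alpha> * exp (v \<alpha> \<bullet> y)) *\<^sub>R v \<alpha>) = 0 \<and>
    d \<le> (\<Sum>\<alpha>\<in>B. c \<alpha> * exp (v \<alpha> \<bullet> y))"
  using assms
proof (induction A rule: finite_psubset_induct)
  case (psubset A)
  define h where "h y = (\<Sum>\<alpha>\<in>A. c \<alpha> * exp (v \<alpha> \<bullet> y))" for y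
  show ?case
  proof (cases "\<exists>u. (\<forall>\<alpha>\<in>A. v \<alpha> \<bullet> u \<le> 0) \<and> (\<exists>\<alpha>\<in>A. v \<alpha> \<bullet> u < 0)")
    case True
    then obtain u where u: "\<And>\<alpha>. \<alpha> \<in> A \<Longrightarrow> v \<alpha> \<bullet> u \<le> 0" "\<exists>\<alpha>\<in>A. v \<alpha> \<bullet> u < 0" by auto
    define C where "C = {\<alpha>\<in>A. v \<alpha> \<bullet> u = 0}"
    have C: "C \<subset> A" using u(2) unfolding C_def by force
    have "d \<le> (\<Sum>\<alpha>\<in>C. c \<alpha> * exp (v \<alpha> \<bullet> y))" for y
    proof (rule tendsto_lowerbound)
      have "((\<lambda>t. c \<alpha> * exp (v \<alpha> \<bullet> (y + t *\<^sub>R u))) \<longlongrightarrow>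
          (if \<alpha> \<in> C then c \<alpha> * exp (v \<alpha> \<bullet> y) else 0)) at_top" if "\<alpha> \<in> A" for \<alpha>
      proof (cases "\<alpha> \<in> C")
        case True
        then show ?thesis by (simp add: C_def inner_add_right)
      next
        case False
        then have neg: "v \<alpha> \<bullet> u < 0" using u(1)[OF that] that by (auto simp: C_def)
        have "filterlim (\<lambda>t. - (v \<alpha> \<bullet> y) + - (v \<alpha> \<bullet> u) * t) at_top at_top"
          by (rule filterlim_tendsto_add_at_top[OF tendsto_const],
              rule filterlim_tendsto_pos_mult_at_top[OF tendsto_const _ filterlim_ident]) (use neg in simp)
        then have "filterlim (\<lambda>t. v \<alpha> \<bullet> y + t * (v \<alpha> \<bullet> u)) at_bot at_top"
          by (simp add: filterlim_uminus_at_bot mult.commute)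
        then have "((\<lambda>t. c \<alpha> * exp (v \<alpha> \<bullet> (y + t *\<^sub>R u))) \<longlongrightarrow> c \<alpha> * 0) at_top"
          by (intro tendsto_mult tendsto_const filterlim_compose[OF exp_at_bot])
            (simp add: inner_add_right)
        then show ?thesis using False by simp
      qed
      then have "((\<lambda>t. h (y + t *\<^sub>R u)) \<longlongrightarrow>
          (\<Sum>\<alpha>\<in>A. if \<alpha> \<in> C then c \<alpha> * exp (v \<alpha> \<bullet> y) else 0)) at_top"
        unfolding h_def by (rule tendsto_sum)
      also have "(\<Sum>\<alpha>\<in>A. if \<alpha> \<in> C then c \<alpha> * exp (v \<alpha> \<bullet> y) else 0) =
          (\<Sum>\<alpha>\<in>C. c \<alpha> * exp (v \<alpha> \<bullet> y))"
        using C psubset.hyps by (simp add: sum.If_cases Int_absorb1 psubset_imp_subset)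
      finally show "((\<lambda>t. h (y + t *\<^sub>R u)) \<longlongrightarrow> (\<Sum>\<alpha>\<in>C. c \<alpha> * exp (v \<alpha> \<bullet> y))) at_top" .
      show "\<forall>\<^sub>F t in at_top. d \<le> h (y + t *\<^sub>R u)" using psubset.prems(3) by (simp add: h_def)
    qed simp
    then have "\<exists>B y. B \<subseteq> C \<and> (\<Sum>\<alpha>\<in>B. (c \<alpha> * exp (v \<alpha> \<bullet> y)) *\<^sub>R v \<alpha>) = 0 \<and>
        d \<le> (\<Sum>\<alpha>\<in>B. c \<alpha> * exp (v \<alpha> \<bullet> y))"
      using psubset.prems C by (intro psubset.IH) auto
    then show ?thesis using C by blast
  next
    case False
    define S where "S = span (v ` A)"
    have pos: "\<exists>\<alpha>\<in>A. 0 < v \<alpha> \<bullet> u" if "u \<in> S" "u \<noteq> 0" for u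
    proof (rule ccontr)
      assume "\<not> ?thesis"
      then have "\<forall>\<alpha>\<in>A. v \<alpha> \<bullet> u \<le> 0" by (auto simp: not_less)
      with False have "\<And>\<alpha>. \<alpha> \<in> A \<Longrightarrow> v \<alpha> \<bullet> u = 0" by (meson antisym_conv1)
      then have "orthogonal u x" if "x \<in> v ` A" for x
        using that by (auto simp: orthogonal_def inner_commute)
      then have "orthogonal u u" using that(1) unfolding S_def by (metis orthogonal_to_span)
      then show False using that(2) by (simp add: orthogonal_def)
    qed
    \<comment> \<open>a positively homogeneous minorant, so that its growth is controlled by its values on
      the unit sphere\<close>
    define \<phi> where "\<phi> u = (\<Sum>\<alpha>\<in>A. c \<alpha> * max 0 (v \<alpha> \<bullet> u))" for u
    have \<phi>_h: "\<phi> u \<le> h u" for u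
      unfolding \<phi>_def h_def
    proof (intro sum_mono mult_left_mono)
      show "max 0 (v \<alpha> \<bullet> u) \<le> exp (v \<alpha> \<bullet> u)" for \<alpha>
        using exp_ge_add_one_self[of "v \<alpha> \<bullet> u"] exp_gt_zero[of "v \<alpha> \<bullet> u"] by linarith
    qed (use psubset.prems in \<open>auto intro: less_imp_le\<close>)
    have \<phi>_pos: "0 < \<phi> u" if u: "u \<in> S" "u \<noteq> 0" for u
    proof -
      obtain \<alpha> where "\<alpha> \<in> A" "0 < v \<alpha> \<bullet> u" using pos[OF u] by auto
      then show ?thesis unfolding \<phi>_def
        using psubset.prems psubset.hyps
        by (intro sum_pos2[of A \<alpha>]) (auto intro!: mult_nonneg_nonneg intro: less_imp_le)
    qed
    have cont\<phi>: "continuous_on X \<phi>" for X unfolding \<phi>_def by (intro continuous_intros)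
    have conth: "continuous_on X h" for X unfolding h_def by (intro continuous_intros)
    have closed: "closed S" "subspace S" by (auto simp: S_def closed_span)
    have "\<exists>\<delta>>0. \<forall>u\<in>S. \<delta> * norm u \<le> \<phi> u"
    proof (cases "S \<inter> sphere 0 1 = {}")
      case True
      have only0: "u = 0" if "u \<in> S" for u
      proof (rule ccontr)
        assume "u \<noteq> 0"
        then have "u /\<^sub>R norm u \<in> S \<inter> sphere 0 1"
          using that closed by (auto intro: subspace_scale)
        then show False using True by blast
      qed
      then have "\<phi> u = 0 \<and> norm u = 0" if u: "u \<in> S" for u
        unfolding only0[OF u] by (simp add: \<phi>_def)
      then have "\<forall>u\<in>S. 1 * norm u \<le> \<phi> u" by simp
      then show ?thesis using zero_less_one by blast
    next
      case False
      moreover have "compact (S \<inter> sphere 0 1)" using closed by (simp add: closed_Int_compact)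
      ultimately obtain u0 where u0: "u0 \<in> S \<inter> sphere 0 1"
        "\<And>u. u \<in> S \<inter> sphere 0 1 \<Longrightarrow> \<phi> u0 \<le> \<phi> u"
        using continuous_attains_inf[OF _ _ cont\<phi>] by metis
      have "\<phi> u0 * norm u \<le> \<phi> u" if "u \<in> S" for u
      proof (cases "u = 0")
        case False
        have "\<phi> u0 \<le> \<phi> (u /\<^sub>R norm u)"
          using that closed False by (intro u0) (auto intro: subspace_scale)
        also have "\<phi> (u /\<^sub>R norm u) = \<phi> u / norm u"
        proof -
          have "max 0 (v \<alpha> \<bullet> u / norm u) = max 0 (v \<alpha> \<bullet> u) / norm u" for \<alpha>
            using False by (auto simp: max_def divide_le_0_iff zero_le_divide_iff)
          then show ?thesis by (simp add: \<phi>_def sum_divide_distrib divide_inverse_commute[symmetric])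
        qed
        finally show ?thesis using False by (simp add: field_simps)
      qed (simp add: \<phi>_def)
      moreover have "0 < \<phi> u0" using u0(1) by (intro \<phi>_pos) auto
      ultimately show ?thesis by blast
    qed
    then obtain \<delta> where \<delta>: "0 < \<delta>" "\<And>u. u \<in> S \<Longrightarrow> \<delta> * norm u \<le> \<phi> u" by auto
    \<comment> \<open>on \<open>S\<close>, outside the ball of radius \<open>R\<close>, the sum exceeds its value at \<open>0\<close>\<close>
    define R where "R = h 0 / \<delta>"
    have h0: "0 \<le> h 0" unfolding h_def using psubset.prems by (intro sum_nonneg) (auto intro: less_imp_le)
    have zero: "0 \<in> S \<inter> cball 0 R" using closed h0 \<delta> by (auto simp: R_def subspace_0)
    have "compact (S \<inter> cball 0 R)" using closed by (simp add: closed_Int_compact)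
    then obtain y where y: "y \<in> S \<inter> cball 0 R" "\<And>z. z \<in> S \<inter> cball 0 R \<Longrightarrow> h y \<le> h z"
      using continuous_attains_inf[OF _ _ conth] zero by (metis empty_iff)
    have min: "h y \<le> h z" if "z \<in> S" for z
    proof (cases "z \<in> cball 0 R")
      case False
      then have "h 0 \<le> \<delta> * norm z" using \<delta>(1) by (simp add: R_def field_simps)
      also have "\<dots> \<le> h z" using \<delta>(2)[OF that] \<phi>_h[of z] by simp
      finally show ?thesis using y(2)[OF zero] by simp
    qed (use y that in auto)
    define G where "G = (\<Sum>\<alpha>\<in>A. (c \<alpha> * exp (v \<alpha> \<bullet> y)) *\<^sub>R v \<alpha>)"
    have G: "G \<in> S" unfolding G_def S_def
      by (intro span_sum span_scale) (auto intro: span_base)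
    have "((\<lambda>t. h (y + t *\<^sub>R G)) has_real_derivative G \<bullet> G) (at 0)"
    proof -
      have "((\<lambda>t. h (y + t *\<^sub>R G)) has_real_derivative
          (\<Sum>\<alpha>\<in>A. c \<alpha> * (exp (v \<alpha> \<bullet> y + 0 * (v \<alpha> \<bullet> G)) * (v \<alpha> \<bullet> G)))) (at 0)"
        unfolding h_def inner_add_right inner_scaleR_right
        by (auto intro!: derivative_eq_intros sum.cong)
      moreover have "G \<bullet> G = (\<Sum>\<alpha>\<in>A. c \<alpha> * exp (v \<alpha> \<bullet> y) * (v \<alpha> \<bullet> G))"
        by (subst (1) G_def) (simp add: inner_sum_left)
      ultimately show ?thesis by (simp add: mult.assoc)
    qed
    then have "G \<bullet> G = 0"
      by (rule DERIV_local_min[where d = 1]) (use min y G closed in \<open>auto intro!: subspace_add subspace_scale\<close>)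
    then have "G = 0" by simp
    then show ?thesis using psubset.prems(3)[of y] unfolding G_def by blast
  qed
qed

section \<open>The cone of polynomials decomposable over a fixed support\<close>

text \<open>
  The index sets are those of the fixed polynomial \<open>f\<close> while the decomposed polynomial \<open>p\<close>
  varies. This makes the decomposable polynomials a convex cone, in which a decomposition of \<open>f\<close>
  can be assembled summand by summand. The free coefficients \<open>m\<close> of the squares are forced only
  in the case \<open>p = f\<close>.
\<close>

definition decomposable :: "'n::finite rpoly \<Rightarrow> 'n rpoly \<Rightarrow> bool" where
  "decomposable f p \<longleftrightarrow> (\<exists>F m.
     (\<forall>\<beta>\<in>\<Gamma> f. \<forall>\<Delta>\<in>\<F> f \<beta>. nonneg_circuit_on \<Delta> \<beta> (F \<beta> \<Delta>)) \<and>
     (\<forall>\<alpha>\<in>\<I> f. 0 \<le> m \<alpha>) \<and>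
     p = (\<Sum>\<beta>\<in>\<Gamma> f. \<Sum>\<Delta>\<in>\<F> f \<beta>. F \<beta> \<Delta>) + (\<Sum>\<alpha>\<in>\<I> f. Poly_Mapping.single \<alpha> (m \<alpha>)))"

lemma finite_\<I>: "finite (\<I> f)"
  by (rule finite_subset[OF _ finite_\<Lambda>[of f]]) (auto simp: \<I>_def)

lemma finite_\<Gamma>: "finite (\<Gamma> f)"
  by (simp add: \<Gamma>_def)

lemma nonneg_circuit_on_0: "nonneg_circuit_on \<Delta> \<beta> 0"
  unfolding nonneg_circuit_on_def
  by (intro conjI exI[of _ "\<lambda>_. 0"] exI[of _ 0]) (auto simp: nonneg_poly_def)

lemma nonneg_circuit_on_add:
  assumes "nonneg_circuit_on \<Delta> \<beta> g" "nonneg_circuit_on \<Delta> \<beta> h"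
  shows "nonneg_circuit_on \<Delta> \<beta> (g + h)"
proof -
  obtain a d where g: "\<forall>\<alpha>\<in>vertex_exps \<Delta>. 0 \<le> a \<alpha>" "nonneg_poly g"
    "g = (\<Sum>\<alpha>\<in>vertex_exps \<Delta>. Poly_Mapping.single \<alpha> (a \<alpha>)) - Poly_Mapping.single \<beta> d"
    using assms(1) unfolding nonneg_circuit_on_def by auto
  obtain b e where h: "\<forall>\<alpha>\<in>vertex_exps \<Delta>. 0 \<le> b \<alpha>" "nonneg_poly h"
    "h = (\<Sum>\<alpha>\<in>vertex_exps \<Delta>. Poly_Mapping.single \<alpha> (b \<alpha>)) - Poly_Mapping.single \<beta> e"
    using assms(2) unfolding nonneg_circuit_on_def by auto
  have "g + h = (\<Sum>\<alpha>\<in>vertex_exps \<Delta>. Poly_Mapping.single \<alpha> (a \<alpha> + b \<alpha>)) - Poly_Mapping.single \<beta> (d + e)"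
    unfolding g(3) h(3) by (simp add: single_add sum.distrib)
  then show ?thesis
    unfolding nonneg_circuit_on_def using g(1,2) h(1,2)
    by (intro conjI nonneg_poly_add exI[of _ "\<lambda>\<alpha>. a \<alpha> + b \<alpha>"] exI[of _ "d + e"]) auto
qed

lemma decomposable_0: "decomposable f 0"
  unfolding decomposable_def
  by (rule exI[of _ "\<lambda>_ _. 0"], rule exI[of _ "\<lambda>_. 0"]) (simp add: nonneg_circuit_on_0)

lemma decomposable_add:
  assumes "decomposable f p" "decomposable f q"
  shows "decomposable f (p + q)"
proof -
  obtain F m where p: "\<forall>\<beta>\<in>\<Gamma> f. \<forall>\<Delta>\<in>\<F> f \<beta>. nonneg_circuit_on \<Delta> \<beta> (F \<beta> \<Delta>)" "\<forall>\<alpha>\<in>\<I> f. 0 \<le> m \<alpha>"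
    "p = (\<Sum>\<beta>\<in>\<Gamma> f. \<Sum>\<Delta>\<in>\<F> f \<beta>. F \<beta> \<Delta>) + (\<Sum>\<alpha>\<in>\<I> f. Poly_Mapping.single \<alpha> (m \<alpha>))"
    using assms(1) unfolding decomposable_def by blast
  obtain G k where q: "\<forall>\<beta>\<in>\<Gamma> f. \<forall>\<Delta>\<in>\<F> f \<beta>. nonneg_circuit_on \<Delta> \<beta> (G \<beta> \<Delta>)" "\<forall>\<alpha>\<in>\<I> f. 0 \<le> k \<alpha>"
    "q = (\<Sum>\<beta>\<in>\<Gamma> f. \<Sum>\<Delta>\<in>\<F> f \<beta>. G \<beta> \<Delta>) + (\<Sum>\<alpha>\<in>\<I> f. Poly_Mapping.single \<alpha> (k \<alpha>))"
    using assms(2) unfolding decomposable_def by blast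
  show ?thesis
    unfolding decomposable_def
  proof (intro exI conjI ballI)
    show "nonneg_circuit_on \<Delta> \<beta> (F \<beta> \<Delta> + G \<beta> \<Delta>)" if "\<beta> \<in> \<Gamma> f" "\<Delta> \<in> \<F> f \<beta>" for \<beta> \<Delta>
      using that p q by (simp add: nonneg_circuit_on_add)
    show "0 \<le> m \<alpha> + k \<alpha>" if "\<alpha> \<in> \<I> f" for \<alpha> using that p q by simp
    show "p + q = (\<Sum>\<beta>\<in>\<Gamma> f. \<Sum>\<Delta>\<in>\<F> f \<beta>. F \<beta> \<Delta> + G \<beta> \<Delta>) +
        (\<Sum>\<alpha>\<in>\<I> f. Poly_Mapping.single \<alpha> (m \<alpha> + k \<alpha>))"
      unfolding p(3) q(3) by (simp add: sum.distrib single_add)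
  qed
qed

lemma decomposable_sum:
  "(\<And>k. k \<in> K \<Longrightarrow> decomposable f (p k)) \<Longrightarrow> decomposable f (\<Sum>k\<in>K. p k)"
  by (induction K rule: infinite_finite_induct) (auto intro: decomposable_0 decomposable_add)

lemma decomposable_circuit:
  assumes "\<beta> \<in> \<Gamma> f" "\<Delta> \<in> \<F> f \<beta>" "nonneg_circuit_on \<Delta> \<beta> p"
  shows "decomposable f p"
proof -
  define F where "F \<gamma> D = (if \<gamma> = \<beta> then if D = \<Delta> then p else 0 else 0)" for \<gamma> D
  have "(\<Sum>D\<in>\<F> f \<gamma>. F \<gamma> D) = (if \<gamma> = \<beta> then p else 0)" for \<gamma>
    using assms(2) by (simp add: F_def finite_\<F>)
  then have "(\<Sum>\<gamma>\<in>\<Gamma> f. \<Sum>D\<in>\<F> f \<gamma>. F \<gamma> D) = p"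
    using assms(1) by (simp add: finite_\<Gamma>)
  then show ?thesis
    unfolding decomposable_def
    using assms(3) by (intro exI[of _ F] exI[of _ "\<lambda>_. 0"]) (simp add: F_def nonneg_circuit_on_0)
qed

lemma sum_single_if:
  assumes "finite S" "\<alpha> \<in> S"
  shows "(\<Sum>\<gamma>\<in>S. Poly_Mapping.single \<gamma> (if \<gamma> = \<alpha> then r else 0)) = Poly_Mapping.single \<alpha> r"
  by (rule poly_mapping_eqI) (use assms in \<open>auto simp: lookup_sum_single lookup_single when_def\<close>)

text \<open>
  A square whose exponent is a vertex of one of the simplices is itself a nonnegative circuit
  polynomial on that simplex, with vanishing inner coefficient. So separate squares are needed
  only at the exponents in \<open>\<I> f\<close>.
\<close>

lemma decomposable_square:
  assumes "\<alpha> \<in> \<Lambda> f" "0 \<le> r"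
  shows "decomposable f (Poly_Mapping.single \<alpha> r)"
proof (cases "\<alpha> \<in> \<I> f")
  case True
  then show ?thesis
    unfolding decomposable_def using assms(2)
    by (intro exI[of _ "\<lambda>_ _. 0"] exI[of _ "\<lambda>\<gamma>. if \<gamma> = \<alpha> then r else 0"])
      (simp add: nonneg_circuit_on_0 finite_\<I> sum_single_if)
next
  case False
  then obtain \<beta> \<Delta> where \<Delta>: "\<beta> \<in> \<Gamma> f" "\<Delta> \<in> \<F> f \<beta>" "\<alpha> \<in> vertex_exps \<Delta>"
    using assms(1) by (auto simp: \<I>_def)
  have "nonneg_poly (Poly_Mapping.single \<alpha> r)"
    using assms by (intro nonneg_poly_single) (auto simp: \<Lambda>_def)
  then have "nonneg_circuit_on \<Delta> \<beta> (Poly_Mapping.single \<alpha> r)"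
    unfolding nonneg_circuit_on_def using assms(2) \<Delta>(3) finite_vertex_exps[OF \<Delta>(2)]
    by (intro conjI exI[of _ "\<lambda>\<gamma>. if \<gamma> = \<alpha> then r else 0"] exI[of _ 0]) (auto simp: sum_single_if)
  then show ?thesis using \<Delta> by (intro decomposable_circuit)
qed

section \<open>Circuit pieces from balanced weights\<close>

text \<open>
  The points off the coordinate hyperplanes are dense, and only there is the
  logarithmic substitution \<open>\<bar>x\<^sub>i\<bar> = exp z\<^sub>i\<close> available.
\<close>

lemma nonneg_poly_if_nonneg_off_axes:
  fixes f :: "'n::finite rpoly"
  assumes "\<And>x. (\<And>i. x $ i \<noteq> 0) \<Longrightarrow> 0 \<le> eval_poly f x"
  shows "nonneg_poly f"
  unfolding nonneg_poly_def
proof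
  fix x :: "real ^ 'n"
  show "0 \<le> eval_poly f x"
  proof (rule tendsto_lowerbound)
    have "((\<lambda>t. eval_poly f (\<chi> i. x $ i + t)) \<longlongrightarrow> eval_poly f (\<chi> i. x $ i + 0)) (at_right 0)"
      unfolding eval_poly_def by (auto intro!: tendsto_eq_intros)
    then show "((\<lambda>t. eval_poly f (\<chi> i. x $ i + t)) \<longlongrightarrow> eval_poly f x) (at_right 0)"
      by simp
    have "\<forall>\<^sub>F t in at_right 0. x $ i + t \<noteq> 0" for i
    proof (cases "x $ i = 0")
      case True
      then show ?thesis by (auto simp: eventually_at_right_less intro: eventually_mono[OF eventually_at_right_less])
    next
      case False
      have "((\<lambda>t. x $ i + t) \<longlongrightarrow> x $ i + 0) (at_right 0)" by (intro tendsto_intros)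
      then show ?thesis using False by (intro tendsto_imp_eventually_ne) auto
    qed
    then have "\<forall>\<^sub>F t in at_right 0. \<forall>i. x $ i + t \<noteq> 0"
      by (intro eventually_all_finite)
    then show "\<forall>\<^sub>F t in at_right 0. 0 \<le> eval_poly f (\<chi> i. x $ i + t)"
      by (rule eventually_mono) (rule assms, simp)
  qed simp
qed

text \<open>
  This is the weighted inequality of arithmetic and geometric means. In logarithmic coordinates
  \<open>z\<close> and after division by \<open>exp (point \<beta> \<bullet> z)\<close>, the sum over \<open>A\<close> becomes
  \<open>\<Sum>\<alpha>\<in>A. \<nu> \<alpha> * exp ((point \<alpha> - point \<beta>) \<bullet> (z - y))\<close>. Bounding each exponential by its
  tangent \<open>1 + u\<close> leaves \<open>sum \<nu> A\<close>, because the linear parts cancel by balance.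
\<close>

lemma balanced_exponential_nonneg:
  fixes \<nu> :: "nat ^ 'n::finite \<Rightarrow> real"
  assumes "finite A" "\<And>\<alpha>. \<alpha> \<in> A \<Longrightarrow> even_exp \<alpha>" "\<And>\<alpha>. \<alpha> \<in> A \<Longrightarrow> 0 \<le> \<nu> \<alpha>"
    and bal: "(\<Sum>\<alpha>\<in>A. \<nu> \<alpha> *\<^sub>R (point \<alpha> - point \<beta>)) = 0"
    and "\<bar>q\<bar> \<le> 1"
  shows "nonneg_poly ((\<Sum>\<alpha>\<in>A. Poly_Mapping.single \<alpha> (\<nu> \<alpha> / exp ((point \<alpha> - point \<beta>) \<bullet> y)))
    - Poly_Mapping.single \<beta> (q * (\<Sum>\<alpha>\<in>A. \<nu> \<alpha>)))"
proof (rule nonneg_poly_if_nonneg_off_axes)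
  fix x :: "real ^ 'n"
  assume x: "\<And>i. x $ i \<noteq> 0"
  define z :: "real ^ 'n" where "z = (\<chi> i. ln \<bar>x $ i\<bar>)"
  have mono: "(\<Prod>i\<in>UNIV. \<bar>x $ i\<bar> ^ (\<gamma> $ i)) = exp (point \<gamma> \<bullet> z)" for \<gamma>
    unfolding exp_inner_point using x by (simp add: z_def)
  define M where "M = (\<Prod>i\<in>UNIV. (x $ i) ^ (\<beta> $ i))"
  have M: "\<bar>M\<bar> = exp (point \<beta> \<bullet> z)"
    unfolding M_def mono[symmetric] by (simp add: abs_prod power_abs)
  have "(\<Sum>\<alpha>\<in>A. \<nu> \<alpha>) = (\<Sum>\<alpha>\<in>A. \<nu> \<alpha>) + (\<Sum>\<alpha>\<in>A. \<nu> \<alpha> *\<^sub>R (point \<alpha> - point \<beta>)) \<bullet> (z - y)"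
    using bal by simp
  also have "\<dots> = (\<Sum>\<alpha>\<in>A. \<nu> \<alpha> * (1 + (point \<alpha> - point \<beta>) \<bullet> (z - y)))"
    by (simp add: inner_sum_left sum.distrib distrib_left)
  also have "\<dots> \<le> (\<Sum>\<alpha>\<in>A. \<nu> \<alpha> * exp ((point \<alpha> - point \<beta>) \<bullet> (z - y)))"
    using assms(3) by (intro sum_mono mult_left_mono exp_ge_add_one_self)
  finally have key: "(\<Sum>\<alpha>\<in>A. \<nu> \<alpha>) \<le> (\<Sum>\<alpha>\<in>A. \<nu> \<alpha> * exp ((point \<alpha> - point \<beta>) \<bullet> (z - y)))" .
  have N: "0 \<le> (\<Sum>\<alpha>\<in>A. \<nu> \<alpha>)" using assms(3) by (rule sum_nonneg)
  have "q * (\<Sum>\<alpha>\<in>A. \<nu> \<alpha>) * M \<le> \<bar>q * (\<Sum>\<alpha>\<in>A. \<nu> \<alpha>) * M\<bar>" by simp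
  also have "\<dots> = \<bar>q\<bar> * ((\<Sum>\<alpha>\<in>A. \<nu> \<alpha>) * exp (point \<beta> \<bullet> z))"
    using N M by (simp add: abs_mult)
  also have "\<dots> \<le> 1 * ((\<Sum>\<alpha>\<in>A. \<nu> \<alpha>) * exp (point \<beta> \<bullet> z))"
    using N assms(5) by (intro mult_right_mono) auto
  also have "\<dots> \<le> (\<Sum>\<alpha>\<in>A. \<nu> \<alpha> * exp ((point \<alpha> - point \<beta>) \<bullet> (z - y))) * exp (point \<beta> \<bullet> z)"
    using key by simp
  also have "\<dots> = (\<Sum>\<alpha>\<in>A. \<nu> \<alpha> / exp ((point \<alpha> - point \<beta>) \<bullet> y) * exp (point \<alpha> \<bullet> z))"
  proof -
    have "exp ((point \<alpha> - point \<beta>) \<bullet> (z - y)) * exp (point \<beta> \<bullet> z) =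
        exp (point \<alpha> \<bullet> z) / exp ((point \<alpha> - point \<beta>) \<bullet> y)" for \<alpha>
      by (simp add: inner_diff_right inner_diff_left algebra_simps flip: exp_add exp_diff)
    then show ?thesis by (simp add: sum_distrib_right mult.assoc)
  qed
  also have "\<dots> = (\<Sum>\<alpha>\<in>A. \<nu> \<alpha> / exp ((point \<alpha> - point \<beta>) \<bullet> y) * (\<Prod>i\<in>UNIV. (x $ i) ^ (\<alpha> $ i)))"
    by (intro sum.cong refl) (use assms(2) in \<open>simp add: even_monomial_abs mono\<close>)
  finally show "0 \<le> eval_poly ((\<Sum>\<alpha>\<in>A. Poly_Mapping.single \<alpha> (\<nu> \<alpha> / exp ((point \<alpha> - point \<beta>) \<bullet> y)))
    - Poly_Mapping.single \<beta> (q * (\<Sum>\<alpha>\<in>A. \<nu> \<alpha>))) x"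
    by (simp add: eval_poly_diff eval_poly_sum eval_poly_single M_def)
qed

lemma independent_simplex:
  fixes B :: "(nat ^ 'n::finite) set"
  assumes "finite B" "B \<noteq> {}" "\<not> affine_dependent (point ` B)"
  shows "is_simplex (convex hull (point ` B))" "vertex_exps (convex hull (point ` B)) = B"
    "vertices (convex hull (point ` B)) = point ` B"
proof -
  have "card (point ` B) \<noteq> 0" using assms by simp
  then have "int (card (point ` B)) = int (card (point ` B) - 1) + 1" by simp
  then show "is_simplex (convex hull (point ` B))"
    using assms(3) unfolding is_simplex_def simplex_def by blast
  show v: "vertices (convex hull (point ` B)) = point ` B"
    using extreme_point_of_convex_hull_affine_independent[OF assms(3)]
    unfolding vertices_def by auto
  show "vertex_exps (convex hull (point ` B)) = B"
    unfolding vertex_exps_def v using inj_point by (auto dest: injD)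
qed

text \<open>
  Balance says that \<open>point \<beta>\<close> is the barycenter of the exponents in \<open>B\<close> with weights proportional
  to \<open>\<nu>\<close>.
\<close>

lemma balanced_in_rel_interior:
  fixes \<nu> :: "nat ^ 'n::finite \<Rightarrow> real"
  assumes "finite B" "B \<noteq> {}" "\<And>\<alpha>. \<alpha> \<in> B \<Longrightarrow> 0 < \<nu> \<alpha>"
    and bal: "(\<Sum>\<alpha>\<in>B. \<nu> \<alpha> *\<^sub>R (point \<alpha> - point \<beta>)) = 0"
  shows "point \<beta> \<in> rel_interior (convex hull (point ` B))"
proof -
  have inj: "inj_on point B" using inj_point by (rule inj_on_subset) simp
  define N where "N = sum \<nu> B"
  have N: "0 < N" unfolding N_def using assms by (intro sum_pos) auto
  define u where "u v = \<nu> (inv_into B point v) / N" for v :: "real ^ 'n"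
  have u: "u (point \<alpha>) = \<nu> \<alpha> / N" if "\<alpha> \<in> B" for \<alpha>
    using that inj by (simp add: u_def)
  have "(\<Sum>\<alpha>\<in>B. \<nu> \<alpha> *\<^sub>R point \<alpha>) = N *\<^sub>R point \<beta>"
    using bal by (simp add: scaleR_diff_right sum_subtractf N_def scaleR_left.sum)
  moreover have "(\<Sum>\<alpha>\<in>B. (\<nu> \<alpha> / N) *\<^sub>R point \<alpha>) = (1 / N) *\<^sub>R (\<Sum>\<alpha>\<in>B. \<nu> \<alpha> *\<^sub>R point \<alpha>)"
    by (simp add: scaleR_sum_right)
  ultimately have "(\<Sum>\<alpha>\<in>B. (\<nu> \<alpha> / N) *\<^sub>R point \<alpha>) = point \<beta>"
    using N by simp
  moreover have "(\<Sum>\<alpha>\<in>B. \<nu> \<alpha> / N) = 1" using N by (simp add: N_def flip: sum_divide_distrib)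
  ultimately have "(\<forall>x\<in>point ` B. 0 < u x) \<and> sum u (point ` B) = 1 \<and>
      (\<Sum>x\<in>point ` B. u x *\<^sub>R x) = point \<beta>"
    using assms(3) N inj by (auto simp: sum.reindex u)
  then show ?thesis
    using explicit_subset_rel_interior_convex_hull_minimal[of "point ` B"] assms(1) by blast
qed

text \<open>
  Both the polynomial and the balance condition are linear in \<open>\<nu>\<close>, so the splitting of \<open>\<nu>\<close> into
  weights with affinely independent supports splits the polynomial. Each part lives on the
  vertices of a simplex and is nonnegative by the inequality of means. Since \<open>q\<close> and \<open>y\<close> are common to all parts,
  their inner coefficients add up to the prescribed one.
\<close>

lemma decomposable_balanced:
  fixes f :: "'n::finite rpoly"
  assumes \<beta>: "\<beta> \<in> \<Gamma> f" and A: "A \<subseteq> \<Lambda> f"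
    and \<nu>: "\<And>\<alpha>. \<alpha> \<in> A \<Longrightarrow> 0 \<le> \<nu> \<alpha>"
    and bal: "(\<Sum>\<alpha>\<in>A. \<nu> \<alpha> *\<^sub>R (point \<alpha> - point \<beta>)) = 0"
    and q: "\<bar>q\<bar> \<le> 1"
  shows "decomposable f ((\<Sum>\<alpha>\<in>A. Poly_Mapping.single \<alpha> (\<nu> \<alpha> / exp ((point \<alpha> - point \<beta>) \<bullet> y)))
    - Poly_Mapping.single \<beta> (q * (\<Sum>\<alpha>\<in>A. \<nu> \<alpha>)))"
proof -
  define T where "T \<mu> = (\<Sum>\<alpha>\<in>A. Poly_Mapping.single \<alpha> (\<mu> \<alpha> / exp ((point \<alpha> - point \<beta>) \<bullet> y)))
    - Poly_Mapping.single \<beta> (q * (\<Sum>\<alpha>\<in>A. \<mu> \<alpha>))" for \<mu>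
  have fin: "finite A" using A finite_\<Lambda> by (rule finite_subset)
  define \<nu>' where "\<nu>' \<alpha> = (if \<alpha> \<in> A then \<nu> \<alpha> else 0)" for \<alpha>
  have "decomposable f (T \<nu>')"
  proof (rule balanced_weights_induct[where A = A and p = point and b = "point \<beta>" and P = "\<lambda>\<mu>. decomposable f (T \<mu>)"])
    show "finite A" by (rule fin)
    show "inj_on point A" using inj_point by (rule inj_on_subset) simp
    show "decomposable f (T (\<lambda>\<alpha>. 0))" by (simp add: T_def decomposable_0)
    fix \<mu> \<kappa> assume "decomposable f (T \<mu>)" "decomposable f (T \<kappa>)"
    then have "decomposable f (T \<mu> + T \<kappa>)" by (rule decomposable_add)
    moreover have "T \<mu> + T \<kappa> = T (\<lambda>\<alpha>. \<mu> \<alpha> + \<kappa> \<alpha>)"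
      by (simp add: T_def add_divide_distrib single_add sum.distrib distrib_left)
    ultimately show "decomposable f (T (\<lambda>\<alpha>. \<mu> \<alpha> + \<kappa> \<alpha>))" by simp
  next
    fix B \<mu>
    assume B: "B \<subseteq> A" "B \<noteq> {}" "\<not> affine_dependent (point ` B)"
      and pos: "\<And>\<alpha>. \<alpha> \<in> B \<Longrightarrow> 0 < \<mu> \<alpha>" and off: "\<And>\<alpha>. \<alpha> \<notin> B \<Longrightarrow> \<mu> \<alpha> = 0"
      and bal: "(\<Sum>\<alpha>\<in>B. \<mu> \<alpha> *\<^sub>R (point \<alpha> - point \<beta>)) = 0"
    have finB: "finite B" using B(1) fin by (rule finite_subset)
    let ?\<Delta> = "convex hull (point ` B)"
    note simplex = independent_simplex[OF finB B(2,3)]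
    have \<Delta>: "?\<Delta> \<in> \<F> f \<beta>"
      using simplex balanced_in_rel_interior[OF finB B(2) pos bal] A B(1) by (auto simp: \<F>_def)
    have "(\<Sum>\<alpha>\<in>A. Poly_Mapping.single \<alpha> (\<mu> \<alpha> / exp ((point \<alpha> - point \<beta>) \<bullet> y))) =
        (\<Sum>\<alpha>\<in>B. Poly_Mapping.single \<alpha> (\<mu> \<alpha> / exp ((point \<alpha> - point \<beta>) \<bullet> y)))"
      "sum \<mu> A = sum \<mu> B"
      by (rule sum.mono_neutral_right; use B fin off in auto)+
    then have T: "T \<mu> = (\<Sum>\<alpha>\<in>B. Poly_Mapping.single \<alpha> (\<mu> \<alpha> / exp ((point \<alpha> - point \<beta>) \<bullet> y)))
        - Poly_Mapping.single \<beta> (q * sum \<mu> B)"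
      by (simp add: T_def)
    have "nonneg_poly (T \<mu>)"
      unfolding T using finB _ _ bal q
    proof (rule balanced_exponential_nonneg)
      show "even_exp \<alpha>" if "\<alpha> \<in> B" for \<alpha> using that A B(1) by (auto simp: \<Lambda>_def)
    qed (auto intro: less_imp_le pos)
    then have "nonneg_circuit_on ?\<Delta> \<beta> (T \<mu>)"
      unfolding nonneg_circuit_on_def simplex(2)
      by (intro conjI exI[of _ "\<lambda>\<alpha>. \<mu> \<alpha> / exp ((point \<alpha> - point \<beta>) \<bullet> y)"] exI[of _ "q * sum \<mu> B"])
        (auto simp: T less_imp_le[OF pos])
    then show "decomposable f (T \<mu>)" using \<beta> \<Delta> by (intro decomposable_circuit)
  next
    show "0 \<le> \<nu>' \<alpha>" for \<alpha> using \<nu> by (simp add: \<nu>'_def)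
    show "\<nu>' \<alpha> = 0" if "\<alpha> \<notin> A" for \<alpha> using that by (simp add: \<nu>'_def)
    show "(\<Sum>\<alpha>\<in>A. \<nu>' \<alpha> *\<^sub>R (point \<alpha> - point \<beta>)) = 0" using bal by (simp add: \<nu>'_def)
  qed
  then show ?thesis by (simp add: T_def \<nu>'_def)
qed

section \<open>AGE polynomials and their decomposition\<close>

text \<open>
  These are the AGE polynomials (\<open>arithmetic-geometric exponentials\<close>): nonnegative polynomials
  with at most one term, the one at \<open>\<beta>\<close>, that is not a monomial square.
\<close>

definition age_poly :: "nat ^ 'n::finite \<Rightarrow> 'n rpoly \<Rightarrow> bool" where
  "age_poly \<beta> g \<longleftrightarrow> nonneg_poly g \<and>
    (\<forall>\<alpha>. \<alpha> \<noteq> \<beta> \<longrightarrow> 0 \<le> Poly_Mapping.lookup g \<alpha> \<and> (Poly_Mapping.lookup g \<alpha> \<noteq> 0 \<longrightarrow> even_exp \<alpha>))"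

lemma age_poly_0: "age_poly \<beta> 0"
  by (simp add: age_poly_def nonneg_poly_def)

lemma age_poly_add:
  assumes "age_poly \<beta> g" "age_poly \<beta> h"
  shows "age_poly \<beta> (g + h)"
  unfolding age_poly_def
proof (intro conjI allI impI)
  fix \<alpha> assume \<alpha>: "\<alpha> \<noteq> \<beta>"
  show "0 \<le> Poly_Mapping.lookup (g + h) \<alpha>"
    using assms \<alpha> by (simp add: age_poly_def lookup_add)
  assume "Poly_Mapping.lookup (g + h) \<alpha> \<noteq> 0"
  then have "Poly_Mapping.lookup g \<alpha> \<noteq> 0 \<or> Poly_Mapping.lookup h \<alpha> \<noteq> 0"
    by (auto simp: lookup_add)
  then show "even_exp \<alpha>" using assms \<alpha> by (auto simp: age_poly_def)
qed (use assms in \<open>auto simp: age_poly_def intro: nonneg_poly_add\<close>)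

lemma decomposable_squares:
  assumes "\<And>\<alpha>. Poly_Mapping.lookup g \<alpha> \<noteq> 0 \<Longrightarrow> \<alpha> \<in> \<Lambda> f \<and> 0 \<le> Poly_Mapping.lookup g \<alpha>"
  shows "decomposable f g"
proof -
  have "decomposable f (\<Sum>\<alpha>\<in>Poly_Mapping.keys g. Poly_Mapping.single \<alpha> (Poly_Mapping.lookup g \<alpha>))"
    by (intro decomposable_sum decomposable_square) (use assms in \<open>auto simp: in_keys_iff\<close>)
  then show ?thesis using sum_single_lookup[of "Poly_Mapping.keys g" g] by simp
qed

text \<open>
  Evaluate \<open>g\<close> at the point with coordinates \<open>\<plusminus> exp y\<^sub>i\<close>, with the signs chosen to make the term
  at \<open>\<beta>\<close> nonpositive. The other terms have even exponents and do not see the signs.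
\<close>

lemma age_coefficient_bound:
  fixes g :: "'n::finite rpoly"
  assumes g: "age_poly \<beta> g" and sgn: "even_exp \<beta> \<Longrightarrow> Poly_Mapping.lookup g \<beta> \<le> 0"
  shows "\<bar>Poly_Mapping.lookup g \<beta>\<bar> \<le>
    (\<Sum>\<alpha>\<in>Poly_Mapping.keys g - {\<beta>}. Poly_Mapping.lookup g \<alpha> * exp ((point \<alpha> - point \<beta>) \<bullet> y))"
proof -
  let ?c = "Poly_Mapping.lookup g"
  obtain s :: "'n \<Rightarrow> real" where s: "\<And>i. \<bar>s i\<bar> = 1"
    "?c \<beta> * (\<Prod>i\<in>UNIV. s i ^ (\<beta> $ i)) = - \<bar>?c \<beta>\<bar>"
  proof (cases "?c \<beta> \<le> 0")
    case True
    then show ?thesis using that[of "\<lambda>_. 1"] by simp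
  next
    case False
    \<comment> \<open>a positive coefficient is possible only at a non-even exponent; flip one odd coordinate\<close>
    then obtain j where j: "odd (\<beta> $ j)" using sgn by (auto simp: even_exp_def)
    define s where "s i = (if i = j then - 1 else 1 :: real)" for i
    have "(\<Prod>i\<in>UNIV. s i ^ (\<beta> $ i)) = (\<Prod>i\<in>UNIV. if i = j then - 1 else 1)"
      using j by (intro prod.cong) (auto simp: s_def)
    then show ?thesis using that[of s] False by (auto simp: s_def)
  qed
  define x :: "real ^ 'n" where "x = (\<chi> i. s i * exp (y $ i))"
  have split: "(\<Prod>i\<in>UNIV. (x $ i) ^ (\<gamma> $ i)) = (\<Prod>i\<in>UNIV. s i ^ (\<gamma> $ i)) * exp (point \<gamma> \<bullet> y)" for \<gamma>
    by (simp add: x_def exp_inner_point power_mult_distrib prod.distrib)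
  have even: "(\<Prod>i\<in>UNIV. (x $ i) ^ (\<alpha> $ i)) = exp (point \<alpha> \<bullet> y)" if "even_exp \<alpha>" for \<alpha>
    using even_monomial_abs[OF that, of x] s(1) by (simp add: x_def exp_inner_point abs_mult)
  have "0 \<le> eval_poly g x" using g by (simp add: age_poly_def nonneg_poly_def)
  also have "eval_poly g x = (\<Sum>\<alpha>\<in>insert \<beta> (Poly_Mapping.keys g - {\<beta>}).
      ?c \<alpha> * (\<Prod>i\<in>UNIV. (x $ i) ^ (\<alpha> $ i)))"
    by (rule eval_poly_superset) auto
  also have "\<dots> = - \<bar>?c \<beta>\<bar> * exp (point \<beta> \<bullet> y) +
      (\<Sum>\<alpha>\<in>Poly_Mapping.keys g - {\<beta>}. ?c \<alpha> * (\<Prod>i\<in>UNIV. (x $ i) ^ (\<alpha> $ i)))"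
    by (subst sum.insert) (auto simp: split s(2) simp flip: mult.assoc)
  also have "(\<Sum>\<alpha>\<in>Poly_Mapping.keys g - {\<beta>}. ?c \<alpha> * (\<Prod>i\<in>UNIV. (x $ i) ^ (\<alpha> $ i))) =
      (\<Sum>\<alpha>\<in>Poly_Mapping.keys g - {\<beta>}. ?c \<alpha> * exp (point \<alpha> \<bullet> y))"
    by (intro sum.cong refl) (use g in \<open>auto simp: age_poly_def even in_keys_iff\<close>)
  also have "\<dots> = (\<Sum>\<alpha>\<in>Poly_Mapping.keys g - {\<beta>}. ?c \<alpha> * exp ((point \<alpha> - point \<beta>) \<bullet> y)) * exp (point \<beta> \<bullet> y)"
    unfolding sum_distrib_right
    by (intro sum.cong refl) (simp add: inner_diff_left mult.assoc flip: exp_add)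
  finally have "0 \<le> (- \<bar>?c \<beta>\<bar> + (\<Sum>\<alpha>\<in>Poly_Mapping.keys g - {\<beta>}. ?c \<alpha> * exp ((point \<alpha> - point \<beta>) \<bullet> y)))
      * exp (point \<beta> \<bullet> y)"
    by (simp add: distrib_right)
  then show ?thesis by (simp add: zero_le_mult_iff)
qed

text \<open>
  If the coefficient at \<open>\<beta>\<close> is zero, \<open>g\<close> is a sum of monomial squares. Otherwise its absolute
  value is a positive lower bound for an exponential sum. A
  stationary point \<open>y\<close> of a subsum turns the values of its terms into weights \<open>\<nu>\<close> that are
  balanced around \<open>\<beta>\<close> with total at least \<open>\<bar>Poly_Mapping.lookup g \<beta>\<bar>\<close>. Dividing \<open>\<nu>\<close> by the
  exponentials at the same \<open>y\<close> gives back the coefficients of \<open>g\<close>, so this part of \<open>g\<close> together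
  with the term at \<open>\<beta>\<close> is decomposable; the remaining terms are squares.
\<close>

lemma age_decomposable:
  assumes \<beta>: "\<beta> \<in> \<Gamma> f" and g: "age_poly \<beta> g"
    and sgn: "even_exp \<beta> \<Longrightarrow> Poly_Mapping.lookup g \<beta> \<le> 0"
    and supp: "\<And>\<alpha>. \<alpha> \<noteq> \<beta> \<Longrightarrow> Poly_Mapping.lookup g \<alpha> \<noteq> 0 \<Longrightarrow> \<alpha> \<in> \<Lambda> f"
  shows "decomposable f g"
proof (cases "Poly_Mapping.lookup g \<beta> = 0")
  case True
  show ?thesis
  proof (rule decomposable_squares)
    fix \<alpha> assume "Poly_Mapping.lookup g \<alpha> \<noteq> 0"
    moreover from this have "\<alpha> \<noteq> \<beta>" using True by auto
    ultimately show "\<alpha> \<in> \<Lambda> f \<and> 0 \<le> Poly_Mapping.lookup g \<alpha>"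
      using g supp by (simp add: age_poly_def)
  qed
next
  case False
  let ?c = "Poly_Mapping.lookup g"
  define A where "A = Poly_Mapping.keys g - {\<beta>}"
  have A: "finite A" "A \<subseteq> \<Lambda> f" using supp by (auto simp: A_def in_keys_iff)
  have pos: "0 < ?c \<alpha>" if "\<alpha> \<in> A" for \<alpha>
    using that g by (auto simp: A_def in_keys_iff age_poly_def less_le)
  have "\<exists>B y. B \<subseteq> A \<and> (\<Sum>\<alpha>\<in>B. (?c \<alpha> * exp ((point \<alpha> - point \<beta>) \<bullet> y)) *\<^sub>R (point \<alpha> - point \<beta>)) = 0 \<and>
      \<bar>?c \<beta>\<bar> \<le> (\<Sum>\<alpha>\<in>B. ?c \<alpha> * exp ((point \<alpha> - point \<beta>) \<bullet> y))"
    using age_coefficient_bound[OF g sgn] False pos A(1)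
    by (intro stationary_subsum) (auto simp: A_def)
  then obtain B y where B: "B \<subseteq> A"
    and bal: "(\<Sum>\<alpha>\<in>B. (?c \<alpha> * exp ((point \<alpha> - point \<beta>) \<bullet> y)) *\<^sub>R (point \<alpha> - point \<beta>)) = 0"
    and bound: "\<bar>?c \<beta>\<bar> \<le> (\<Sum>\<alpha>\<in>B. ?c \<alpha> * exp ((point \<alpha> - point \<beta>) \<bullet> y))"
    by blast
  define N where "N = (\<Sum>\<alpha>\<in>B. ?c \<alpha> * exp ((point \<alpha> - point \<beta>) \<bullet> y))"
  have N: "0 < N" "\<bar>?c \<beta>\<bar> \<le> N" using bound False by (auto simp: N_def)
  have "decomposable f ((\<Sum>\<alpha>\<in>B. Poly_Mapping.single \<alpha>
      (?c \<alpha> * exp ((point \<alpha> - point \<beta>) \<bullet> y) / exp ((point \<alpha> - point \<beta>) \<bullet> y)))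
      - Poly_Mapping.single \<beta> ((- ?c \<beta> / N) * N))"
    unfolding N_def
  proof (rule decomposable_balanced[OF \<beta> _ _ bal])
    show "B \<subseteq> \<Lambda> f" using A B by auto
    show "0 \<le> ?c \<alpha> * exp ((point \<alpha> - point \<beta>) \<bullet> y)" if "\<alpha> \<in> B" for \<alpha>
      using pos[of \<alpha>] that B by auto
    show "\<bar>- ?c \<beta> / (\<Sum>\<alpha>\<in>B. ?c \<alpha> * exp ((point \<alpha> - point \<beta>) \<bullet> y))\<bar> \<le> 1"
      using N unfolding N_def[symmetric] by simp
  qed
  then have 1: "decomposable f ((\<Sum>\<alpha>\<in>B. Poly_Mapping.single \<alpha> (?c \<alpha>)) + Poly_Mapping.single \<beta> (?c \<beta>))"
    using N by (simp add: single_uminus)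
  have 2: "decomposable f (\<Sum>\<alpha>\<in>A - B. Poly_Mapping.single \<alpha> (?c \<alpha>))"
    using A pos by (intro decomposable_sum decomposable_square) (auto intro: less_imp_le)
  have "g = (\<Sum>\<alpha>\<in>insert \<beta> A. Poly_Mapping.single \<alpha> (?c \<alpha>))"
    using A(1) by (intro sum_single_lookup) (auto simp: A_def)
  also have "\<dots> = Poly_Mapping.single \<beta> (?c \<beta>) + (\<Sum>\<alpha>\<in>A. Poly_Mapping.single \<alpha> (?c \<alpha>))"
    using A(1) by (subst sum.insert) (auto simp: A_def)
  also have "(\<Sum>\<alpha>\<in>A. Poly_Mapping.single \<alpha> (?c \<alpha>)) =
      (\<Sum>\<alpha>\<in>A - B. Poly_Mapping.single \<alpha> (?c \<alpha>)) + (\<Sum>\<alpha>\<in>B. Poly_Mapping.single \<alpha> (?c \<alpha>))"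
    by (rule sum.subset_diff) (use A B in auto)
  finally have "g = ((\<Sum>\<alpha>\<in>B. Poly_Mapping.single \<alpha> (?c \<alpha>)) + Poly_Mapping.single \<beta> (?c \<beta>)) +
      (\<Sum>\<alpha>\<in>A - B. Poly_Mapping.single \<alpha> (?c \<alpha>))"
    by (simp add: ac_simps)
  then show ?thesis using decomposable_add[OF 1 2] by simp
qed

lemma nonneg_circuit_poly_age:
  assumes "nonneg_circuit_poly p"
  shows "\<exists>\<beta>. age_poly \<beta> p"
  using assms unfolding nonneg_circuit_poly_def
proof (elim disjE conjE)
  assume "circuit_poly p" "nonneg_poly p"
  then obtain A c d \<beta> where p: "trellis A" "\<forall>\<alpha>\<in>A. 0 < c \<alpha>"
    "p = (\<Sum>\<alpha>\<in>A. Poly_Mapping.single \<alpha> (c \<alpha>)) - Poly_Mapping.single \<beta> d"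
    unfolding circuit_poly_def by blast
  have A: "finite A" "\<forall>\<alpha>\<in>A. even_exp \<alpha>" using p(1) by (auto simp: trellis_def)
  have "Poly_Mapping.lookup p \<alpha> = (if \<alpha> \<in> A then c \<alpha> else 0)" if "\<alpha> \<noteq> \<beta>" for \<alpha>
    using that A(1) by (simp add: p(3) lookup_minus lookup_sum_single lookup_single_not_eq)
  then have "age_poly \<beta> p"
    using A p(2) \<open>nonneg_poly p\<close> by (auto simp: age_poly_def less_imp_le)
  then show ?thesis ..
next
  assume "monomial_square p"
  then obtain \<alpha> c where p: "0 < c" "even_exp \<alpha>" "p = Poly_Mapping.single \<alpha> c"
    unfolding monomial_square_def by blast
  have "nonneg_poly p" using p by (simp add: nonneg_poly_single)
  then have "age_poly \<alpha> p" by (simp add: age_poly_def p(3) lookup_single_not_eq)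
  then show ?thesis ..
qed

text \<open>
  Circuit polynomials with the same inner exponent are added up, which leaves one AGE polynomial
  for each inner exponent.
\<close>

lemma SONC_age_sum:
  assumes "f \<in> SONC"
  shows "\<exists>B g. finite B \<and> (\<forall>\<beta>. age_poly \<beta> (g \<beta>)) \<and> f = (\<Sum>\<beta>\<in>B. g \<beta>)"
proof -
  obtain ps where ps: "f = sum_list ps" "\<forall>p\<in>set ps. nonneg_circuit_poly p"
    using assms by (auto simp: SONC_def)
  from ps(2) have "\<exists>B g. finite B \<and> (\<forall>\<beta>. age_poly \<beta> (g \<beta>)) \<and> sum_list ps = (\<Sum>\<beta>\<in>B. g \<beta>)"
  proof (induction ps)
    case Nil
    show ?case by (intro exI[of _ "{}"] exI[of _ "\<lambda>_. 0"]) (simp add: age_poly_0)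
  next
    case (Cons p ps)
    then obtain B g where Bg: "finite B" "\<forall>\<beta>. age_poly \<beta> (g \<beta>)" "sum_list ps = (\<Sum>\<beta>\<in>B. g \<beta>)"
      by auto
    obtain \<beta> where \<beta>: "age_poly \<beta> p" using Cons.prems nonneg_circuit_poly_age by auto
    define h where "h \<gamma> = (if \<gamma> = \<beta> then p else 0) + (if \<gamma> \<in> B then g \<gamma> else 0)" for \<gamma>
    have "age_poly \<gamma> (h \<gamma>)" for \<gamma>
      unfolding h_def using \<beta> Bg(2) by (intro age_poly_add) (auto simp: age_poly_0)
    moreover have "(\<Sum>\<gamma>\<in>insert \<beta> B. h \<gamma>) = p + (\<Sum>\<gamma>\<in>B. g \<gamma>)"
    proof -
      have "(\<Sum>\<gamma>\<in>insert \<beta> B. if \<gamma> \<in> B then g \<gamma> else 0) = (\<Sum>\<gamma>\<in>B. g \<gamma>)"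
        by (rule sum.mono_neutral_cong_right) (use Bg(1) in auto)
      then show ?thesis using Bg(1) by (simp add: h_def sum.distrib)
    qed
    ultimately show ?case
      using Bg by (intro exI[of _ "insert \<beta> B"] exI[of _ h]) auto
  qed
  then show ?thesis using ps(1) by simp
qed

section \<open>Removing cancellation between AGE polynomials\<close>

text \<open>
  No cancellation at \<open>\<gamma>\<close>: for AGE polynomials \<open>g \<beta>\<close> only \<open>g \<gamma>\<close> can have a negative coefficient at
  \<open>\<gamma>\<close>, and it may have one only if no other summand contributes there.
\<close>

definition settled :: "(nat ^ 'n::finite) set \<Rightarrow> (nat ^ 'n \<Rightarrow> 'n rpoly) \<Rightarrow> nat ^ 'n \<Rightarrow> bool" where
  "settled B g \<gamma> \<longleftrightarrow> 0 \<le> Poly_Mapping.lookup (g \<gamma>) \<gamma> \<or> (\<forall>\<beta>\<in>B - {\<gamma>}. Poly_Mapping.lookup (g \<beta>) \<gamma> = 0)"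

text \<open>
  Let \<open>d > 0\<close> be the negated coefficient of \<open>g \<gamma>\<close> at \<open>\<gamma>\<close> and \<open>P\<close> the sum of the coefficients
  that the other summands have there. Distribute \<open>g \<gamma>\<close> among the others in proportion to these
  coefficients, using up the fraction \<open>P / max P d\<close> of it. If \<open>P \<ge> d\<close>, all of \<open>g \<gamma>\<close> is used up and
  the others keep nonnegative coefficients at \<open>\<gamma>\<close>; if \<open>P \<le> d\<close>, the others lose their coefficients at
  \<open>\<gamma>\<close> altogether. An exponent \<open>\<delta>\<close> that was settled before stays settled: adding a multiple of
  \<open>g \<gamma>\<close>, whose coefficient at \<open>\<delta>\<close> is nonnegative, cannot make the coefficient of \<open>g \<delta>\<close> negative,
  and if no summand but \<open>g \<delta>\<close> contributes at \<open>\<delta>\<close>, then neither do their combinations.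
\<close>

lemma settle_one:
  fixes g :: "nat ^ 'n::finite \<Rightarrow> 'n rpoly"
  assumes B: "finite B" "\<gamma> \<in> B" and g: "\<And>\<beta>. age_poly \<beta> (g \<beta>)"
  obtains h where "\<And>\<beta>. age_poly \<beta> (h \<beta>)" "(\<Sum>\<beta>\<in>B. h \<beta>) = (\<Sum>\<beta>\<in>B. g \<beta>)"
    "settled B h \<gamma>" "\<And>\<delta>. settled B g \<delta> \<Longrightarrow> settled B h \<delta>"
proof (cases "settled B g \<gamma>")
  case True
  then show ?thesis using that[of g] g by auto
next
  case False
  define d where "d = - Poly_Mapping.lookup (g \<gamma>) \<gamma>"
  define P where "P = (\<Sum>\<beta>\<in>B - {\<gamma>}. Poly_Mapping.lookup (g \<beta>) \<gamma>)"
  define M where "M = max P d"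
  have d: "0 < d" using False by (auto simp: settled_def d_def)
  then have M: "0 < M" "d \<le> M" "P \<le> M" by (auto simp: M_def)
  \<comment> \<open>the shares \<open>r \<beta>\<close> of \<open>g \<gamma>\<close> received by the summands add up to zero\<close>
  define r where "r \<beta> = (if \<beta> = \<gamma> then - (P / M) else Poly_Mapping.lookup (g \<beta>) \<gamma> / M)" for \<beta>
  define h where "h \<beta> = g \<beta> + Poly_Mapping.map ((*) (r \<beta>)) (g \<gamma>)" for \<beta>
  have lh: "Poly_Mapping.lookup (h \<beta>) \<alpha> =
      Poly_Mapping.lookup (g \<beta>) \<alpha> + r \<beta> * Poly_Mapping.lookup (g \<gamma>) \<alpha>" for \<beta> \<alpha>
    by (simp add: h_def lookup_add lookup_scale)
  have nn: "0 \<le> Poly_Mapping.lookup (g \<beta>) \<alpha>" "Poly_Mapping.lookup (g \<beta>) \<alpha> \<noteq> 0 \<longrightarrow> even_exp \<alpha>"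
    if "\<alpha> \<noteq> \<beta>" for \<alpha> \<beta> using g[of \<beta>] that by (auto simp: age_poly_def)
  have r: "0 \<le> r \<beta>" if "\<beta> \<noteq> \<gamma>" for \<beta>
    using that M(1) nn(1)[of \<gamma> \<beta>] by (simp add: r_def)
  have r1: "0 \<le> 1 + r \<gamma>" using M by (simp add: r_def)
  have at\<gamma>: "Poly_Mapping.lookup (h \<beta>) \<gamma> = Poly_Mapping.lookup (g \<beta>) \<gamma> * ((M - d) / M)"
    if "\<beta> \<noteq> \<gamma>" for \<beta>
    using that M by (simp add: lh r_def d_def field_simps)
  have own: "Poly_Mapping.lookup (h \<gamma>) \<alpha> = (1 + r \<gamma>) * Poly_Mapping.lookup (g \<gamma>) \<alpha>" for \<alpha>
    by (simp add: lh distrib_right)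
  have age: "age_poly \<beta> (h \<beta>)" for \<beta>
    unfolding age_poly_def
  proof (intro conjI allI impI)
    have ev: "nonneg_poly (g \<beta>)" for \<beta> using g by (simp add: age_poly_def)
    have eval: "eval_poly (h \<beta>) x = eval_poly (g \<beta>) x + r \<beta> * eval_poly (g \<gamma>) x" for x
      by (simp add: h_def eval_poly_add eval_poly_scale)
    show "nonneg_poly (h \<beta>)"
    proof (cases "\<beta> = \<gamma>")
      case True
      then have "eval_poly (h \<beta>) x = (1 + r \<gamma>) * eval_poly (g \<gamma>) x" for x
        unfolding eval unfolding True by (simp add: distrib_right)
      then show ?thesis using r1 ev[of \<gamma>] by (simp add: nonneg_poly_def)
    next
      case False
      then show ?thesis using r[OF False] ev[of \<beta>] ev[of \<gamma>] by (simp add: nonneg_poly_def eval)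
    qed
  next
    fix \<alpha> assume \<alpha>: "\<alpha> \<noteq> \<beta>"
    show "0 \<le> Poly_Mapping.lookup (h \<beta>) \<alpha>"
    proof (cases "\<beta> = \<gamma>")
      case True
      then show ?thesis using r1 nn(1) \<alpha> by (simp add: own)
    next
      case False
      show ?thesis
      proof (cases "\<alpha> = \<gamma>")
        case True
        then show ?thesis using at\<gamma>[OF False] M nn(1) \<alpha> by simp
      next
        case nr: False
        then show ?thesis using r[OF False] nn(1)[OF nr] nn(1)[OF \<alpha>] by (simp add: lh)
      qed
    qed
    assume nz: "Poly_Mapping.lookup (h \<beta>) \<alpha> \<noteq> 0"
    show "even_exp \<alpha>"
    proof (cases "\<alpha> = \<gamma>")
      case True
      then show ?thesis using nz at\<gamma>[of \<beta>] nn(2)[OF \<alpha>] \<alpha> by auto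
    next
      case False
      then show ?thesis using nz nn(2)[OF \<alpha>] nn(2)[OF False] by (auto simp: lh)
    qed
  qed
  have total: "(\<Sum>\<beta>\<in>B. h \<beta>) = (\<Sum>\<beta>\<in>B. g \<beta>)"
  proof (rule poly_mapping_eqI)
    fix \<alpha>
    have "sum r B = r \<gamma> + (\<Sum>\<beta>\<in>B - {\<gamma>}. Poly_Mapping.lookup (g \<beta>) \<gamma> / M)"
      using B by (subst sum.remove[of B \<gamma>]) (auto simp: r_def)
    also have "\<dots> = 0" by (simp add: r_def P_def flip: sum_divide_distrib)
    finally have "sum r B = 0" .
    then show "Poly_Mapping.lookup (\<Sum>\<beta>\<in>B. h \<beta>) \<alpha> = Poly_Mapping.lookup (\<Sum>\<beta>\<in>B. g \<beta>) \<alpha>"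
      by (simp add: lookup_sum lh sum.distrib flip: sum_distrib_right)
  qed
  have "settled B h \<gamma>"
  proof (cases "P \<le> d")
    case True
    then have "M = d" by (simp add: M_def)
    then show ?thesis by (auto simp: settled_def at\<gamma>)
  next
    case False
    then have "1 + r \<gamma> = 0" using M by (simp add: r_def M_def)
    then show ?thesis by (simp add: settled_def own)
  qed
  moreover have "settled B h \<delta>" if "settled B g \<delta>" for \<delta>
  proof (cases "\<delta> = \<gamma>")
    case False
    show ?thesis
    proof (cases "0 \<le> Poly_Mapping.lookup (g \<delta>) \<delta>")
      case True
      then show ?thesis using r[OF False] nn(1)[OF False] by (simp add: settled_def lh)
    next
      case neg: False
      then have "\<forall>\<beta>\<in>B - {\<delta>}. Poly_Mapping.lookup (g \<beta>) \<delta> = 0" using that by (simp add: settled_def)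
      then show ?thesis using B(2) False by (auto simp: settled_def lh)
    qed
  qed (use \<open>settled B h \<gamma>\<close> in simp)
  ultimately show ?thesis using that[of h] age total by blast
qed

lemma settle_all:
  fixes g :: "nat ^ 'n::finite \<Rightarrow> 'n rpoly"
  assumes "finite B" "\<And>\<beta>. age_poly \<beta> (g \<beta>)"
  obtains h where "\<And>\<beta>. age_poly \<beta> (h \<beta>)" "(\<Sum>\<beta>\<in>B. h \<beta>) = (\<Sum>\<beta>\<in>B. g \<beta>)"
    "\<And>\<gamma>. \<gamma> \<in> B \<Longrightarrow> settled B h \<gamma>"
proof -
  have "\<exists>h. (\<forall>\<beta>. age_poly \<beta> (h \<beta>)) \<and> (\<Sum>\<beta>\<in>B. h \<beta>) = (\<Sum>\<beta>\<in>B. g \<beta>) \<and> (\<forall>\<gamma>\<in>C. settled B h \<gamma>)"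
    if "finite C" "C \<subseteq> B" for C
    using that
  proof (induction C rule: finite_induct)
    case empty
    show ?case using assms(2) by auto
  next
    case (insert \<gamma> C)
    then obtain h where h: "\<forall>\<beta>. age_poly \<beta> (h \<beta>)" "(\<Sum>\<beta>\<in>B. h \<beta>) = (\<Sum>\<beta>\<in>B. g \<beta>)"
      "\<forall>\<gamma>\<in>C. settled B h \<gamma>" by auto
    obtain k where k: "\<And>\<beta>. age_poly \<beta> (k \<beta>)" "(\<Sum>\<beta>\<in>B. k \<beta>) = (\<Sum>\<beta>\<in>B. h \<beta>)"
      "settled B k \<gamma>" "\<And>\<delta>. settled B h \<delta> \<Longrightarrow> settled B k \<delta>"
      using settle_one[of B \<gamma> h] insert.prems assms(1) h(1) by auto
    then show ?case using h by (intro exI[of _ k]) auto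
  qed
  from this[OF assms(1) subset_refl] show ?thesis using that by blast
qed

text \<open>
  Without cancellation, every exponent \<open>\<alpha> \<noteq> \<beta>\<close> of \<open>g \<beta>\<close> survives in \<open>f\<close> with a positive
  coefficient. So either \<open>\<beta> \<in> \<Gamma> f\<close>, and the decomposition of AGE polynomials applies within the
  support of \<open>f\<close>, or \<open>g \<beta>\<close> is a sum of monomial squares.
\<close>

lemma settled_piece_decomposable:
  assumes B: "finite B" and g: "\<And>\<beta>. age_poly \<beta> (g \<beta>)" and f: "f = (\<Sum>\<beta>\<in>B. g \<beta>)"
    and settled: "\<And>\<gamma>. \<gamma> \<in> B \<Longrightarrow> settled B g \<gamma>" and \<beta>: "\<beta> \<in> B"
  shows "decomposable f (g \<beta>)"
proof -
  have lf: "Poly_Mapping.lookup f \<alpha> = (\<Sum>\<beta>\<in>B. Poly_Mapping.lookup (g \<beta>) \<alpha>)" for \<alpha>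
    by (simp add: f lookup_sum)
  have nn: "0 \<le> Poly_Mapping.lookup (g \<beta>) \<alpha>" "Poly_Mapping.lookup (g \<beta>) \<alpha> \<noteq> 0 \<Longrightarrow> even_exp \<alpha>"
    if "\<alpha> \<noteq> \<beta>" for \<alpha> \<beta> using g[of \<beta>] that by (auto simp: age_poly_def)
  have \<Lambda>I: "\<alpha> \<in> \<Lambda> f" if "even_exp \<alpha>" "0 < Poly_Mapping.lookup f \<alpha>" for \<alpha>
    using that by (simp add: \<Lambda>_def in_keys_iff)
  have supp: "\<alpha> \<in> \<Lambda> f" if \<alpha>: "\<alpha> \<noteq> \<beta>" "Poly_Mapping.lookup (g \<beta>) \<alpha> \<noteq> 0" for \<alpha>
  proof (rule \<Lambda>I)
    show "even_exp \<alpha>" using nn(2) \<alpha> by blast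
    have "0 \<le> Poly_Mapping.lookup (g \<gamma>) \<alpha>" if "\<gamma> \<in> B" for \<gamma>
    proof (cases "\<gamma> = \<alpha>")
      case True
      then show ?thesis using settled[OF that] \<beta> \<alpha> by (auto simp: settled_def)
    qed (use nn(1) in auto)
    moreover have "0 < Poly_Mapping.lookup (g \<beta>) \<alpha>" using nn(1)[OF \<alpha>(1)] \<alpha>(2) by simp
    ultimately show "0 < Poly_Mapping.lookup f \<alpha>"
      unfolding lf using B \<beta> by (intro sum_pos2[of B \<beta>]) auto
  qed
  have own: "Poly_Mapping.lookup f \<beta> =
      Poly_Mapping.lookup (g \<beta>) \<beta> + (\<Sum>\<gamma>\<in>B - {\<beta>}. Poly_Mapping.lookup (g \<gamma>) \<beta>)"
    unfolding lf using B \<beta> by (rule sum.remove)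
  have rest: "0 \<le> (\<Sum>\<gamma>\<in>B - {\<beta>}. Poly_Mapping.lookup (g \<gamma>) \<beta>)"
    using nn(1) by (intro sum_nonneg) auto
  show ?thesis
  proof (cases "\<beta> \<in> \<Gamma> f")
    case True
    have "Poly_Mapping.lookup (g \<beta>) \<beta> \<le> 0" if "even_exp \<beta>"
      using True that own rest \<Lambda>I[OF that] by (fastforce simp: \<Gamma>_def)
    then show ?thesis using True g supp by (intro age_decomposable)
  next
    case False
    then have \<beta>0: "\<beta> \<in> \<Lambda> f \<or> Poly_Mapping.lookup f \<beta> = 0"
      by (auto simp: \<Gamma>_def in_keys_iff)
    have "0 \<le> Poly_Mapping.lookup (g \<beta>) \<beta>"
    proof (rule ccontr)
      assume neg: "\<not> ?thesis"
      then have "Poly_Mapping.lookup f \<beta> = Poly_Mapping.lookup (g \<beta>) \<beta>"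
        using settled[OF \<beta>] own by (simp add: settled_def)
      then show False using neg \<beta>0 by (auto simp: \<Lambda>_def)
    qed
    moreover have "\<beta> \<in> \<Lambda> f" if "Poly_Mapping.lookup (g \<beta>) \<beta> \<noteq> 0"
      using that calculation own rest \<beta>0 by linarith
    ultimately show ?thesis
      using supp nn(1) by (intro decomposable_squares) metis
  qed
qed

section \<open>Cancellation-free decomposition\<close>

lemma lookup_circuit_off:
  assumes "nonneg_circuit_on \<Delta> \<beta> g" "\<alpha> \<notin> vertex_exps \<Delta>" "\<alpha> \<noteq> \<beta>"
  shows "Poly_Mapping.lookup g \<alpha> = 0"
proof -
  obtain a d where g: "g = (\<Sum>\<gamma>\<in>vertex_exps \<Delta>. Poly_Mapping.single \<gamma> (a \<gamma>)) - Poly_Mapping.single \<beta> d"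
    using assms(1) unfolding nonneg_circuit_on_def by blast
  show ?thesis
    using assms(2,3) by (simp add: g lookup_minus lookup_sum_single lookup_single_not_eq)
qed

text \<open>
  The circuit pieces have no terms at the exponents in \<open>\<I> f\<close>, so the squares there carry the
  full coefficients of \<open>f\<close>.
\<close>

lemma decomposable_self:
  assumes "decomposable f f"
  shows "\<exists>F. (\<forall>\<beta>\<in>\<Gamma> f. \<forall>\<Delta>\<in>\<F> f \<beta>. nonneg_circuit_on \<Delta> \<beta> (F \<beta> \<Delta>)) \<and>
    f = (\<Sum>\<beta>\<in>\<Gamma> f. \<Sum>\<Delta>\<in>\<F> f \<beta>. F \<beta> \<Delta>)
      + (\<Sum>\<alpha>\<in>\<I> f. Poly_Mapping.single \<alpha> (Poly_Mapping.lookup f \<alpha>))"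
proof -
  obtain F m where F: "\<forall>\<beta>\<in>\<Gamma> f. \<forall>\<Delta>\<in>\<F> f \<beta>. nonneg_circuit_on \<Delta> \<beta> (F \<beta> \<Delta>)"
    and f: "f = (\<Sum>\<beta>\<in>\<Gamma> f. \<Sum>\<Delta>\<in>\<F> f \<beta>. F \<beta> \<Delta>) + (\<Sum>\<alpha>\<in>\<I> f. Poly_Mapping.single \<alpha> (m \<alpha>))"
    using assms unfolding decomposable_def by blast
  have "m \<alpha> = Poly_Mapping.lookup f \<alpha>" if \<alpha>: "\<alpha> \<in> \<I> f" for \<alpha>
  proof -
    have "Poly_Mapping.lookup (F \<beta> \<Delta>) \<alpha> = 0" if "\<beta> \<in> \<Gamma> f" "\<Delta> \<in> \<F> f \<beta>" for \<beta> \<Delta>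
      by (rule lookup_circuit_off[of \<Delta> \<beta>]) (use F that \<alpha> in \<open>auto simp: \<I>_def \<Gamma>_def\<close>)
    then have "Poly_Mapping.lookup (\<Sum>\<beta>\<in>\<Gamma> f. \<Sum>\<Delta>\<in>\<F> f \<beta>. F \<beta> \<Delta>) \<alpha> = 0"
      by (simp add: lookup_sum)
    then show ?thesis
      using \<alpha> by (subst f) (simp add: lookup_add lookup_sum_single finite_\<I>)
  qed
  then have "(\<Sum>\<alpha>\<in>\<I> f. Poly_Mapping.single \<alpha> (m \<alpha>)) =
      (\<Sum>\<alpha>\<in>\<I> f. Poly_Mapping.single \<alpha> (Poly_Mapping.lookup f \<alpha>))"
    by (intro sum.cong) auto
  then show ?thesis using F f by (intro exI[of _ F]) simp
qed

theorem theorem1p3: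
  fixes f :: "'n::finite rpoly"
  assumes "f \<in> SONC"
  shows "\<exists>F :: nat ^ 'n \<Rightarrow> (real ^ 'n) set \<Rightarrow> 'n rpoly.
    (\<forall>\<beta>\<in>\<Gamma> f. \<forall>\<Delta>\<in>\<F> f \<beta>. nonneg_circuit_on \<Delta> \<beta> (F \<beta> \<Delta>)) \<and>
    f = (\<Sum>\<beta>\<in>\<Gamma> f. \<Sum>\<Delta>\<in>\<F> f \<beta>. F \<beta> \<Delta>)
      + (\<Sum>\<alpha>\<in>\<I> f. Poly_Mapping.single \<alpha> (Poly_Mapping.lookup f \<alpha>))"
proof -
  obtain B g where Bg: "finite B" "\<forall>\<beta>. age_poly \<beta> (g \<beta>)" "f = (\<Sum>\<beta>\<in>B. g \<beta>)"
    using SONC_age_sum[OF assms] by blast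
  then obtain h where h: "\<And>\<beta>. age_poly \<beta> (h \<beta>)" "(\<Sum>\<beta>\<in>B. h \<beta>) = (\<Sum>\<beta>\<in>B. g \<beta>)"
    "\<And>\<gamma>. \<gamma> \<in> B \<Longrightarrow> settled B h \<gamma>"
    using settle_all[of B g] by blast
  have f: "f = (\<Sum>\<beta>\<in>B. h \<beta>)" using Bg(3) h(2) by simp
  have "decomposable f (\<Sum>\<beta>\<in>B. h \<beta>)"
    by (intro decomposable_sum settled_piece_decomposable[OF Bg(1) h(1) f h(3)])
  then show ?thesis using f by (intro decomposable_self) simp
qed

end
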